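(* Consider the white noise model: one observes a sample path $X^{(n)}$ of $X^{(n)}_t=\int_0^tw(s)\,ds+\frac1{\sqrt n}B_t$, $t\in[0,1]$, with $B$ standard Brownian motion. Let the prior on $w$ be the law of a $p$-exponential random element $W$ in $L_2[0,1]$, $p\in[1,2]$. Assume that the true value of $w$ is contained in the support of $W$, $w_0\in L_2[0,1]$. Furthermore, assume that $\epsilon_n>0$ satisfies $\varphi_{w_0}(\epsilon_n)\le n\epsilon_n^2$ with respect to the $L_2[0,1]$-norm, and is such that for any $C>1$ there exist a constant $R>0$ and measurable sets $X_n\subset L_2[0,1]$ with $$\log N(4\epsilon_n,X_n,\|\cdot\|_{L_2})\le Rn\epsilon_n^2\quad\text{and}\quad\mathbb{P}(W\notin X_n)\le\exp(-Cn\epsilon_n^2).$$ Then, for some $M>0$, $$\Pi_n\left(w:\|w-w_0\|_{L_2}>M\epsilon_n\mid X^{(n)}\right)\to0\quad\text{in }P^{(n)}_{w_0}\text{-probability}.$$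
   Context: $P^{(n)}_w$ is the law of the path $X^{(n)}$ in $C[0,1]$ when the signal is $w$, and $\Pi_n(\cdot\mid X^{(n)})$ is the posterior distribution of $w$ given $X^{(n)}$. Let $p\in[1,2]$, let $\gamma=(\gamma_\ell)_{\ell\in\mathbb{N}}$ be a deterministic decaying sequence of positive reals, and let $\xi_\ell$ be i.i.d. real random variables with density proportional to $\exp(-|x|^p/p)$. A $p$-exponential random element in a separable Banach space $X$ with Schauder basis $\{\psi_\ell\}$ is $W=\sum_\ell\gamma_\ell\xi_\ell\psi_\ell$, where $\gamma$ is such that the series a.s. defines an element of $X$; its law is denoted $\mu$. Here $X=L_2[0,1]$ (for example with $\{\psi_\ell\}$ an orthonormal basis). Sequences $(h_\ell)$ are identified with $\sum_\ell h_\ell\psi_\ell$. Define $\mathcal{Z}=\{h:\|h\|_{\mathcal{Z}}^p=\sum_\ell|h_\ell|^p\gamma_\ell^{-p}<\infty\}$, regarded as a subspace of $X$; $B_X$ is the closed unit ball of $X$. The concentration function is $\varphi_w(\epsilon)=\inf_{h\in\mathcal{Z}:\|h-w\|_X\le\epsilon}\frac1p\|h\|_{\mathcal{Z}}^p-\log\mu(\epsilon B_X)$. $N(\epsilon,A,d)$ is the minimum number of $d$-balls of radius $\epsilon$ needed to cover $A$. *)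

theory Defs
  imports "HOL-Probability.Probability"
begin

definition square_integrable01 :: "(real \<Rightarrow> real) \<Rightarrow> bool" where
  "square_integrable01 f \<longleftrightarrow>
     f \<in> borel_measurable (lebesgue_on {0..1}) \<and>
     integrable (lebesgue_on {0..1}) (\<lambda>x. (f x)\<^sup>2)"

lemma square_integrable01_mult:
  assumes "square_integrable01 f" "square_integrable01 g"
  shows "integrable (lebesgue_on {0..1}) (\<lambda>x. f x * g x)"
proof (rule Bochner_Integration.integrable_bound)
  show "integrable (lebesgue_on {0..1}) (\<lambda>x. (f x)\<^sup>2 + (g x)\<^sup>2)"
    using assms by (auto simp: square_integrable01_def)
  show "(\<lambda>x. f x * g x) \<in> borel_measurable (lebesgue_on {0..1})"
    using assms by (auto simp: square_integrable01_def)
  have "\<bar>a * b\<bar> \<le> a\<^sup>2 + b\<^sup>2" for a b :: real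
  proof -
    have "0 \<le> (\<bar>a\<bar> - \<bar>b\<bar>)\<^sup>2" by simp
    then have "2 * (\<bar>a\<bar> * \<bar>b\<bar>) \<le> a\<^sup>2 + b\<^sup>2"
      by (simp add: power2_diff)
    moreover have "0 \<le> \<bar>a\<bar> * \<bar>b\<bar>" by simp
    ultimately show ?thesis unfolding abs_mult by linarith
  qed
  then show "AE x in lebesgue_on {0..1}. norm (f x * g x) \<le> norm ((f x)\<^sup>2 + (g x)\<^sup>2)"
    by (intro AE_I2) simp
qed

lemma square_integrable01_zero: "square_integrable01 (\<lambda>x. 0)"
  by (simp add: square_integrable01_def)

lemma square_integrable01_add:
  assumes "square_integrable01 f" "square_integrable01 g"
  shows "square_integrable01 (\<lambda>x. f x + g x)"
proof -
  have "integrable (lebesgue_on {0..1}) (\<lambda>x. (f x)\<^sup>2 + (g x)\<^sup>2 + 2 * (f x * g x))"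
    using assms square_integrable01_mult[OF assms] by (auto simp: square_integrable01_def)
  moreover have "(\<lambda>x. (f x)\<^sup>2 + (g x)\<^sup>2 + 2 * (f x * g x)) = (\<lambda>x. (f x + g x)\<^sup>2)"
    by (auto simp: power2_sum)
  ultimately show ?thesis
    using assms by (auto simp: square_integrable01_def)
qed

lemma square_integrable01_scale:
  assumes "square_integrable01 f"
  shows "square_integrable01 (\<lambda>x. c * f x)"
  using assms by (auto simp: square_integrable01_def power_mult_distrib)

definition L2_rel :: "(real \<Rightarrow> real) \<Rightarrow> (real \<Rightarrow> real) \<Rightarrow> bool" where
  "L2_rel f g \<longleftrightarrow> square_integrable01 f \<and> square_integrable01 g \<and>
     (AE x in lebesgue_on {0..1}. f x = g x)"

quotient_type L2 = "real \<Rightarrow> real" / partial: L2_rel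
proof (rule part_equivpI)
  show "\<exists>f. L2_rel f f"
    using square_integrable01_zero by (auto simp: L2_rel_def)
  show "symp L2_rel"
    by (rule sympI) (auto simp: L2_rel_def elim: AE_mp)
  show "transp L2_rel"
    by (rule transpI) (auto simp: L2_rel_def elim!: AE_mp)
qed

instantiation L2 :: real_inner
begin

lift_definition zero_L2 :: L2 is "\<lambda>_. 0"
  by (simp add: L2_rel_def square_integrable01_zero)

lift_definition plus_L2 :: "L2 \<Rightarrow> L2 \<Rightarrow> L2" is "\<lambda>f g x. f x + g x"
  by (auto simp: L2_rel_def square_integrable01_add elim!: AE_mp)

lift_definition scaleR_L2 :: "real \<Rightarrow> L2 \<Rightarrow> L2" is "\<lambda>c f x. c * f x"
  by (auto simp: L2_rel_def square_integrable01_scale elim!: AE_mp)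

definition uminus_L2 :: "L2 \<Rightarrow> L2" where "uminus_L2 f = (-1) *\<^sub>R f"

definition minus_L2 :: "L2 \<Rightarrow> L2 \<Rightarrow> L2" where "minus_L2 f g = f + - g"

lift_definition inner_L2 :: "L2 \<Rightarrow> L2 \<Rightarrow> real"
  is "\<lambda>f g. LINT x|lebesgue_on {0..1}. f x * g x"
  by (intro integral_cong_AE)
     (auto simp: L2_rel_def square_integrable01_def elim!: AE_mp)

definition norm_L2 :: "L2 \<Rightarrow> real" where "norm_L2 f = sqrt (inner f f)"

definition sgn_L2 :: "L2 \<Rightarrow> L2" where "sgn_L2 f = inverse (norm f) *\<^sub>R f"

definition dist_L2 :: "L2 \<Rightarrow> L2 \<Rightarrow> real" where "dist_L2 f g = norm (f - g)"

definition uniformity_L2 :: "(L2 \<times> L2) filter" where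
  "uniformity_L2 = (INF e\<in>{0 <..}. principal {(x, y). dist x y < e})"

definition open_L2 :: "L2 set \<Rightarrow> bool" where
  "open_L2 U \<longleftrightarrow> (\<forall>x\<in>U. eventually (\<lambda>(x', y). x' = x \<longrightarrow> y \<in> U) uniformity)"

instance
proof
  fix f g h :: L2 and a b :: real
  show "f + g + h = f + (g + h)"
    by transfer (auto simp: L2_rel_def square_integrable01_add add.assoc)
  show "f + g = g + f"
    by transfer (auto simp: L2_rel_def square_integrable01_add add.commute)
  show "0 + f = f"
    by transfer (auto simp: L2_rel_def)
  show "- f + f = 0"
    unfolding uminus_L2_def
    by transfer (auto simp: L2_rel_def square_integrable01_add square_integrable01_scale
        square_integrable01_zero)
  show "f - g = f + - g" by (rule minus_L2_def)
  show "a *\<^sub>R (f + g) = a *\<^sub>R f + a *\<^sub>R g"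
    by transfer (auto simp: L2_rel_def square_integrable01_add square_integrable01_scale
        distrib_left)
  show "(a + b) *\<^sub>R f = a *\<^sub>R f + b *\<^sub>R f"
    by transfer (auto simp: L2_rel_def square_integrable01_add square_integrable01_scale
        distrib_right)
  show "a *\<^sub>R b *\<^sub>R f = (a * b) *\<^sub>R f"
    by transfer (auto simp: L2_rel_def square_integrable01_scale mult.assoc[symmetric])
  show "1 *\<^sub>R f = f"
    by transfer (auto simp: L2_rel_def)
  show "sgn f = inverse (norm f) *\<^sub>R f" by (rule sgn_L2_def)
  show "dist f g = norm (f - g)" by (rule dist_L2_def)
  show "(uniformity :: (L2 \<times> L2) filter) = (INF e\<in>{0 <..}. principal {(x, y). dist x y < e})"
    by (rule uniformity_L2_def)
  show "open U \<longleftrightarrow> (\<forall>x\<in>U. eventually (\<lambda>(x', y). x' = x \<longrightarrow> y \<in> U) uniformity)" for U :: "L2 set"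
    by (rule open_L2_def)
  show "inner f g = inner g f"
    by transfer (simp add: mult.commute)
  show "inner (f + g) h = inner f h + inner g h"
    by transfer (auto simp: L2_rel_def distrib_right square_integrable01_mult
        intro!: Bochner_Integration.integral_add)
  show "inner (a *\<^sub>R f) g = a * inner f g"
    by transfer (simp add: mult.assoc)
  show "0 \<le> inner f f"
    by transfer (simp add: integral_nonneg_AE)
  show "inner f f = 0 \<longleftrightarrow> f = 0"
  proof (transfer, goal_cases)
    case (1 f)
    then have sq: "square_integrable01 f" by (simp add: L2_rel_def)
    have "(LINT x|lebesgue_on {0..1}. f x * f x) = 0 \<longleftrightarrow>
          (AE x in lebesgue_on {0..1}. f x * f x = 0)"
      by (rule integral_nonneg_eq_0_iff_AE) (auto simp: square_integrable01_mult sq)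
    then show ?case
      by (simp add: L2_rel_def sq square_integrable01_zero)
  qed
  show "norm f = sqrt (inner f f)" by (rule norm_L2_def)
qed

end

lift_definition L2_primitive :: "L2 \<Rightarrow> real \<Rightarrow> real"
  is "\<lambda>f t. LINT s:{0..t}|lebesgue_on {0..1}. f s"
proof -
  fix f g :: "real \<Rightarrow> real"
  assume *: "L2_rel f g"
  show "(\<lambda>t. LINT s:{0..t}|lebesgue_on {0..1}. f s) =
        (\<lambda>t. LINT s:{0..t}|lebesgue_on {0..1}. g s)"
  proof
    fix t :: real
    have ind: "indicat_real {0..t} \<in> borel_measurable (lebesgue_on {0..1})"
      by (intro measurable_restrict_space1 measurable_completion) simp
    show "(LINT s:{0..t}|lebesgue_on {0..1}. f s) = (LINT s:{0..t}|lebesgue_on {0..1}. g s)"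
      unfolding set_lebesgue_integral_def
      by (intro integral_cong_AE borel_measurable_scaleR ind)
         (use * in \<open>auto simp: L2_rel_def square_integrable01_def elim!: AE_mp\<close>)
  qed
qed

definition schauder_basis :: "(nat \<Rightarrow> 'x::real_normed_vector) \<Rightarrow> bool" where
  "schauder_basis \<psi> \<longleftrightarrow> (\<forall>x. \<exists>!a. (\<lambda>l. a l *\<^sub>R \<psi> l) sums x)"

definition basis_coeff :: "(nat \<Rightarrow> 'x::real_normed_vector) \<Rightarrow> 'x \<Rightarrow> nat \<Rightarrow> real" where
  "basis_coeff \<psi> x = (THE a. (\<lambda>l. a l *\<^sub>R \<psi> l) sums x)"

definition p_exponential_density :: "real \<Rightarrow> real \<Rightarrow> real" where
  "p_exponential_density p x =
     exp (- (\<bar>x\<bar> powr p / p)) / (LINT y|lborel. exp (- (\<bar>y\<bar> powr p / p)))"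

definition p_exponential_element ::
  "real \<Rightarrow> (nat \<Rightarrow> real) \<Rightarrow> (nat \<Rightarrow> 'x::real_normed_vector) \<Rightarrow> 'a measure \<Rightarrow> ('a \<Rightarrow> 'x) \<Rightarrow> bool" where
  "p_exponential_element p \<gamma> \<psi> M W \<longleftrightarrow>
     prob_space M \<and> schauder_basis \<psi> \<and> (\<forall>l. 0 < \<gamma> l) \<and> \<gamma> \<longlonglongrightarrow> 0 \<and>
     W \<in> borel_measurable M \<and>
     (\<exists>\<xi> :: nat \<Rightarrow> 'a \<Rightarrow> real.
        prob_space.indep_vars M (\<lambda>_. borel) \<xi> UNIV \<and>
        (\<forall>l. distributed M lborel (\<xi> l) (\<lambda>x. ennreal (p_exponential_density p x))) \<and>
        (AE \<omega> in M. (\<lambda>l. (\<gamma> l * \<xi> l \<omega>) *\<^sub>R \<psi> l) sums W \<omega>))"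

text \<open>On a separable metric space this is the smallest closed set of full measure.\<close>

definition measure_support :: "'x::topological_space measure \<Rightarrow> 'x set" where
  "measure_support \<mu> = {x. \<forall>U. open U \<longrightarrow> x \<in> U \<longrightarrow> 0 < emeasure \<mu> U}"

definition Z_space ::
  "real \<Rightarrow> (nat \<Rightarrow> real) \<Rightarrow> (nat \<Rightarrow> 'x::real_normed_vector) \<Rightarrow> 'x set" where
  "Z_space p \<gamma> \<psi> = {h. summable (\<lambda>l. \<bar>basis_coeff \<psi> h l\<bar> powr p * \<gamma> l powr (- p))}"

text \<open>This is \<open>\<parallel>h\<parallel>\<^sup>p\<close>, not \<open>\<parallel>h\<parallel>\<close>, for the norm of \<open>Z_space\<close>.\<close>

definition Z_norm_pow ::
  "real \<Rightarrow> (nat \<Rightarrow> real) \<Rightarrow> (nat \<Rightarrow> 'x::real_normed_vector) \<Rightarrow> 'x \<Rightarrow> real" where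
  "Z_norm_pow p \<gamma> \<psi> h = (\<Sum>l. \<bar>basis_coeff \<psi> h l\<bar> powr p * \<gamma> l powr (- p))"

text \<open>Logarithm with \<open>log 0 = -\<infinity>\<close> and \<open>log \<infinity> = \<infinity>\<close>, in contrast to the
  library convention \<open>ln 0 = 0\<close>.\<close>

definition ext_ln :: "ereal \<Rightarrow> ereal" where
  "ext_ln x = (if x \<le> 0 then - \<infinity> else if x = \<infinity> then \<infinity> else ereal (ln (real_of_ereal x)))"

text \<open>Extended-real valued: the infimum over the empty set is \<open>\<infinity>\<close>.\<close>

definition concentration_function ::
  "real \<Rightarrow> (nat \<Rightarrow> real) \<Rightarrow> (nat \<Rightarrow> 'x::real_normed_vector) \<Rightarrow> 'x measure \<Rightarrow> 'x \<Rightarrow> real \<Rightarrow> ereal" where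
  "concentration_function p \<gamma> \<psi> \<mu> w \<epsilon> =
     (INF h\<in>{h \<in> Z_space p \<gamma> \<psi>. norm (h - w) \<le> \<epsilon>}. ereal (1 / p * Z_norm_pow p \<gamma> \<psi> h))
     - ext_ln (ereal (measure \<mu> (cball 0 \<epsilon>)))"

text \<open>Closed balls with centres anywhere in the space; \<open>\<infinity>\<close> if there is no finite cover.\<close>

definition covering_number :: "real \<Rightarrow> 'x::metric_space set \<Rightarrow> enat" where
  "covering_number \<epsilon> A = (INF T\<in>{T. finite T \<and> A \<subseteq> (\<Union>t\<in>T. cball t \<epsilon>)}. enat (card T))"

text \<open>The path space \<open>C[0,1]\<close>, functions being \<open>undefined\<close> outside \<open>[0,1]\<close>. The \<open>\<sigma>\<close>-algebra
  generated by the evaluations is the Borel \<open>\<sigma>\<close>-algebra of the supremum norm.\<close>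

definition C01 :: "(real \<Rightarrow> real) measure" where
  "C01 = restrict_space (\<Pi>\<^sub>M t\<in>{0..1}. borel) {x. continuous_on {0..1} x}"

definition brownian_motion01 :: "'b measure \<Rightarrow> (real \<Rightarrow> 'b \<Rightarrow> real) \<Rightarrow> bool" where
  "brownian_motion01 N B \<longleftrightarrow>
     prob_space N \<and>
     (\<forall>t\<in>{0..1}. B t \<in> borel_measurable N) \<and>
     (\<forall>\<omega>\<in>space N. B 0 \<omega> = 0 \<and> continuous_on {0..1} (\<lambda>t. B t \<omega>)) \<and>
     (\<forall>s t. 0 \<le> s \<longrightarrow> s < t \<longrightarrow> t \<le> 1 \<longrightarrow>
        distributed N lborel (\<lambda>\<omega>. B t \<omega> - B s \<omega>)
          (\<lambda>x. ennreal (normal_density 0 (sqrt (t - s)) x))) \<and>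
     (\<forall>k (\<tau> :: nat \<Rightarrow> real). strict_mono_on {..k} \<tau> \<longrightarrow> \<tau> ` {..k} \<subseteq> {0..1} \<longrightarrow>
        prob_space.indep_vars N (\<lambda>_. borel)
          (\<lambda>i \<omega>. B (\<tau> (Suc i)) \<omega> - B (\<tau> i) \<omega>) {..<k})"

definition white_noise_law ::
  "'b measure \<Rightarrow> (real \<Rightarrow> 'b \<Rightarrow> real) \<Rightarrow> nat \<Rightarrow> L2 \<Rightarrow> (real \<Rightarrow> real) measure" where
  "white_noise_law N B n w =
     distr N C01 (\<lambda>\<omega>. \<lambda>t\<in>{0..1}. L2_primitive w t + 1 / sqrt (real n) * B t \<omega>)"

text \<open>A version of the posterior: a regular conditional distribution of the parameter \<open>w\<close> given
  the observation \<open>x\<close> under the joint law in which \<open>w\<close> has law \<open>\<mu>\<close> and \<open>x\<close> has law \<open>P w\<close> given \<open>w\<close>.\<close>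

definition is_posterior ::
  "'w measure \<Rightarrow> 'x measure \<Rightarrow> ('w \<Rightarrow> 'x measure) \<Rightarrow> ('x \<Rightarrow> 'w measure) \<Rightarrow> bool" where
  "is_posterior \<mu> S P \<kappa> \<longleftrightarrow>
     \<kappa> \<in> S \<rightarrow>\<^sub>M prob_algebra \<mu> \<and>
     (\<forall>A\<in>sets \<mu>. \<forall>E\<in>sets S.
        (\<integral>\<^sup>+w\<in>A. emeasure (P w) E \<partial>\<mu>) =
        (\<integral>\<^sup>+w. (\<integral>\<^sup>+x\<in>E. emeasure (\<kappa> x) A \<partial>P w) \<partial>\<mu>))"

end

(*
  Let P_w be the law of the path for the signal w. Two signals satisfy
  P_w0(E)^2 <= exp(n |w0 - w|^2) P_w(E). For cylinder events this is a pointwise inequality between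
  products of normal densities combined with Bessel's inequality, and approximation by cylinder
  events extends it to all of C[0,1]. Averaging over a ball around w0 bounds P_w0(E) by the marginal
  law of the path, under which the posterior mass of a set integrates to a joint probability. Tests
  based on increments along a grid make that joint probability exponentially small on the sieve, and
  the prior mass of the ball is at least exp(-2 n eps^2): a shift of a p-exponential law by h costs
  at most exp(-|h|_Z^p / p) on symmetric sets, since |x+c|^p + |x-c|^p <= 2|x|^p + 2|c|^p for p <= 2.
  Finally n eps^2 tends to infinity because the prior has no atom at 0.
*)
theory Submission
  imports Defs
begin

section \<open>Shifts of p-exponential laws\<close>

text \<open>The usual argument bounds the denominator of the posterior from below through the
  likelihood ratio on path space, a stochastic exponential. Neither object appears here. The
  likelihood ratio is replaced by the inequality between P_w0(E)^2 and P_w(E); being quadratic in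
  the laws, it is carried through the approximation as the family of affine bounds 2 P <= t K Q +
  1/t with t > 0, and recovered by optimising t. The denominator is avoided by applying the Bayes
  identity only on the event E where the test accepts and yet the posterior leaves mass more than
  delta far from w0. The prior and the noise are treated by one device: a shift is paired with its
  reflection, and the product of the two shifted densities is compared with the square of the
  unshifted one. Write y = n eps^2. The ball around w0 has radius 3 eps: 2 eps from a cutoff and eps
  from replacing w0 by an admissible h. Comparing laws over that ball costs exp(-9 y) and its prior
  mass costs exp(-2 y), so the sieve and the tests must beat exp(-11 y).\<close>

lemma (in prob_space) nn_integral_indep_density:
  fixes X :: "'i \<Rightarrow> 'a \<Rightarrow> real"
  assumes I: "finite I" "I \<noteq> {}"
    and ind: "indep_vars (\<lambda>_. borel) X I"
    and X: "\<And>i. i \<in> I \<Longrightarrow> distributed M lborel (X i) (f i)"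
    and F: "F \<in> borel_measurable (Pi\<^sub>M I (\<lambda>_. borel))"
  shows "(\<integral>\<^sup>+\<omega>. F (\<lambda>i\<in>I. X i \<omega>) \<partial>M)
       = (\<integral>\<^sup>+x. (\<Prod>i\<in>I. f i (x i)) * F x \<partial>Pi\<^sub>M I (\<lambda>_. lborel))"
proof -
  have Xm: "X i \<in> borel_measurable M" if "i \<in> I" for i
    using X[OF that] by (auto simp: distributed_def)
  have fm: "f i \<in> borel_measurable lborel" if "i \<in> I" for i
    using X[OF that] by (auto simp: distributed_def)
  have XP: "(\<lambda>\<omega>. \<lambda>i\<in>I. X i \<omega>) \<in> measurable M (Pi\<^sub>M I (\<lambda>_. borel))"
    using Xm by (intro measurable_restrict)
  have sets_eq: "sets (Pi\<^sub>M I (\<lambda>_. lborel)) = sets (Pi\<^sub>M I (\<lambda>_. borel :: real measure))"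
    by (intro sets_PiM_cong) auto
  have fP: "(\<lambda>x. \<Prod>i\<in>I. f i (x i)) \<in> borel_measurable (Pi\<^sub>M I (\<lambda>_. lborel))"
  proof (intro borel_measurable_prod_ennreal)
    fix i assume i: "i \<in> I"
    show "(\<lambda>x. f i (x i)) \<in> borel_measurable (Pi\<^sub>M I (\<lambda>_. lborel))"
      by (rule measurable_compose[OF measurable_component_singleton[OF i] fm[OF i]])
  qed
  \<comment> \<open>The product theory needs a sigma-finite measure at every index, while
    \<open>X i\<close> is known to be measurable only for \<open>i\<close> in \<open>I\<close>;
    \<open>lborel\<close> fills the other indices.\<close>
  let ?D = "\<lambda>i. if i \<in> I then distr M borel (X i) else lborel"
  interpret D: product_sigma_finite ?D
  proof (rule product_sigma_finite.intro)
    fix i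
    show "sigma_finite_measure (?D i)"
      using prob_space_imp_sigma_finite[OF prob_space_distr[OF Xm]] sigma_finite_lborel
      by (cases "i \<in> I") simp_all
  qed
  interpret L: product_sigma_finite "\<lambda>_. lborel"
    by unfold_locales
  have eq: "density (Pi\<^sub>M I (\<lambda>_. lborel)) (\<lambda>x. \<Prod>i\<in>I. f i (x i)) = Pi\<^sub>M I ?D"
  proof (rule D.PiM_eqI[OF \<open>finite I\<close>])
    show "sets (density (Pi\<^sub>M I (\<lambda>_. lborel)) (\<lambda>x. \<Prod>i\<in>I. f i (x i))) = sets (Pi\<^sub>M I ?D)"
      by (simp, intro sets_PiM_cong) auto
    fix A :: "'i \<Rightarrow> real set"
    assume "\<And>i. i \<in> I \<Longrightarrow> A i \<in> sets (?D i)"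
    then have A: "A i \<in> sets borel" if "i \<in> I" for i using that by fastforce
    have PA: "Pi\<^sub>E I A \<in> sets (Pi\<^sub>M I (\<lambda>_. lborel))"
      using I A by (intro sets_PiM_I_finite) auto
    have "emeasure (density (Pi\<^sub>M I (\<lambda>_. lborel)) (\<lambda>x. \<Prod>i\<in>I. f i (x i))) (Pi\<^sub>E I A)
        = (\<integral>\<^sup>+x. (\<Prod>i\<in>I. f i (x i)) * indicator (Pi\<^sub>E I A) x \<partial>Pi\<^sub>M I (\<lambda>_. lborel))"
      by (rule emeasure_density[OF fP PA])
    also have "\<dots> = (\<integral>\<^sup>+x. (\<Prod>i\<in>I. f i (x i) * indicator (A i) (x i)) \<partial>Pi\<^sub>M I (\<lambda>_. lborel))"
    proof (rule nn_integral_cong)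
      fix x assume "x \<in> space (Pi\<^sub>M I (\<lambda>_. lborel :: real measure))"
      then have "indicator (Pi\<^sub>E I A) x = (\<Prod>i\<in>I. indicator (A i) (x i) :: ennreal)"
        using I by (auto simp: indicator_def space_PiM PiE_iff split: if_splits)
      then show "(\<Prod>i\<in>I. f i (x i)) * indicator (Pi\<^sub>E I A) x
          = (\<Prod>i\<in>I. f i (x i) * indicator (A i) (x i))"
        by (simp add: prod.distrib)
    qed
    also have "\<dots> = (\<Prod>i\<in>I. \<integral>\<^sup>+x. f i x * indicator (A i) x \<partial>lborel)"
      using I A fm by (intro L.product_nn_integral_prod) auto
    also have "\<dots> = (\<Prod>i\<in>I. emeasure (?D i) (A i))"
    proof (rule prod.cong)
      fix i assume i: "i \<in> I"
      have "distr M borel (X i) = density lborel (f i)"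
        using X[OF i] by (auto simp: distributed_def intro!: distr_cong cong: distr_cong)
      then show "(\<integral>\<^sup>+x. f i x * indicator (A i) x \<partial>lborel) = emeasure (?D i) (A i)"
        using i A fm by (simp add: emeasure_density)
    qed simp
    finally show "emeasure (density (Pi\<^sub>M I (\<lambda>_. lborel)) (\<lambda>x. \<Prod>i\<in>I. f i (x i))) (Pi\<^sub>E I A)
        = (\<Prod>i\<in>I. emeasure (?D i) (A i))" .
  qed
  have "distr M (Pi\<^sub>M I (\<lambda>_. borel)) (\<lambda>\<omega>. \<lambda>i\<in>I. X i \<omega>) = Pi\<^sub>M I (\<lambda>i. distr M borel (X i))"
    using indep_vars_iff_distr_eq_PiM'[where M'="\<lambda>_. borel" and X=X, OF I(2)] Xm ind by simp
  also have "\<dots> = Pi\<^sub>M I ?D"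
    by (intro PiM_cong) auto
  finally have D: "distr M (Pi\<^sub>M I (\<lambda>_. borel)) (\<lambda>\<omega>. \<lambda>i\<in>I. X i \<omega>)
      = density (Pi\<^sub>M I (\<lambda>_. lborel)) (\<lambda>x. \<Prod>i\<in>I. f i (x i))"
    using eq by simp
  have "(\<integral>\<^sup>+\<omega>. F (\<lambda>i\<in>I. X i \<omega>) \<partial>M)
      = (\<integral>\<^sup>+x. F x \<partial>distr M (Pi\<^sub>M I (\<lambda>_. borel)) (\<lambda>\<omega>. \<lambda>i\<in>I. X i \<omega>))"
    using F by (intro nn_integral_distr[symmetric] XP) auto
  also have "\<dots> = (\<integral>\<^sup>+x. (\<Prod>i\<in>I. f i (x i)) * F x \<partial>Pi\<^sub>M I (\<lambda>_. lborel))"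
    unfolding D using F by (intro nn_integral_density fP) (simp add: measurable_cong_sets[OF sets_eq refl])
  finally show ?thesis .
qed

text \<open>With q = p/2 <= 1 the function t^q is both concave and subadditive. Concavity is applied
  to the squares of x + c and x - c, whose mean is x^2 + c^2 by the parallelogram identity, and
  subadditivity then splits the result. For p = 2 there is equality.\<close>

lemma powr_add_diff_le:
  fixes x c p :: real
  assumes p: "0 < p" "p \<le> 2"
  shows "\<bar>x + c\<bar> powr p + \<bar>x - c\<bar> powr p \<le> 2 * \<bar>x\<bar> powr p + 2 * \<bar>c\<bar> powr p"
proof -
  define q where "q = p / 2"
  have q: "0 < q" "q \<le> 1" using p by (auto simp: q_def)
  have sq: "\<bar>y\<bar> powr p = (y\<^sup>2) powr q" for y :: real
  proof -
    have "(y\<^sup>2) powr q = (\<bar>y\<bar> powr 2) powr q" by simp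
    also have "\<dots> = \<bar>y\<bar> powr p" unfolding powr_powr by (simp add: q_def)
    finally show ?thesis by simp
  qed
  \<comment> \<open>The tangent line of t^q at t = 1. Scaling by the midpoint \<open>m\<close> of a
    and b turns it into midpoint concavity, because the linear terms then add up to a
    constant.\<close>
  have tangent: "t powr q \<le> q * t + (1 - q)" if "0 \<le> t" for t :: real
    using Youngs_inequality_0[of q "1 - q" t 1] q that by (cases "t = 0") auto
  have concave: "a powr q + b powr q \<le> 2 * ((a + b) / 2) powr q" if "0 \<le> a" "0 \<le> b" for a b :: real
  proof (cases "a + b = 0")
    case False
    define m where "m = (a + b) / 2"
    have m: "0 < m" using that False by (simp add: m_def)
    have "(a / m) powr q + (b / m) powr q \<le> q * (a / m + b / m) + 2 * (1 - q)"
      using tangent[of "a / m"] tangent[of "b / m"] that m by (simp add: algebra_simps)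
    also have "a / m + b / m = (a + b) / m" by (rule add_divide_distrib[symmetric])
    also have "a + b = 2 * m" by (simp add: m_def)
    also have "2 * m / m = 2" using m by simp
    finally have "a powr q / m powr q + b powr q / m powr q \<le> 2"
      using that m by (simp add: powr_divide)
    then have "(a powr q + b powr q) / m powr q \<le> 2" by (simp add: add_divide_distrib)
    then show ?thesis using m by (simp add: m_def[symmetric] pos_divide_le_eq)
  qed (use that add_nonneg_eq_0_iff[of a b] in auto)
  \<comment> \<open>After division by the sum both terms lie in [0,1], where t <= t^q.\<close>
  have subadd: "(a + b) powr q \<le> a powr q + b powr q" if "0 \<le> a" "0 \<le> b" for a b :: real
  proof (cases "a + b = 0")
    case False
    define s where "s = a + b"
    have s: "0 < s" using that False by (simp add: s_def)
    have *: "t \<le> t powr q" if "0 \<le> t" "t \<le> 1" for t :: real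
      using powr_mono'[of q 1 t] q that by simp
    have "1 = s / s" using s by simp
    also have "\<dots> = a / s + b / s" unfolding s_def by (rule add_divide_distrib)
    also have "\<dots> \<le> (a / s) powr q + (b / s) powr q"
      using that s by (intro add_mono *) (auto simp: s_def)
    also have "\<dots> = (a powr q + b powr q) / s powr q"
      using that s by (simp add: powr_divide add_divide_distrib)
    finally show ?thesis using s by (simp add: s_def[symmetric] pos_le_divide_eq)
  qed (use that add_nonneg_eq_0_iff[of a b] in auto)
  have "\<bar>x + c\<bar> powr p + \<bar>x - c\<bar> powr p \<le> 2 * (((x + c)\<^sup>2 + (x - c)\<^sup>2) / 2) powr q"
    unfolding sq by (rule concave) auto
  also have "((x + c)\<^sup>2 + (x - c)\<^sup>2) / 2 = x\<^sup>2 + c\<^sup>2" by (simp add: power2_eq_square algebra_simps)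
  also have "(x\<^sup>2 + c\<^sup>2) powr q \<le> (x\<^sup>2) powr q + (c\<^sup>2) powr q" by (rule subadd) auto
  finally show ?thesis unfolding sq by simp
qed

lemma p_exponential_density_nonneg: "0 \<le> p_exponential_density p x"
  by (simp add: p_exponential_density_def)

lemma p_exponential_density_minus: "p_exponential_density p (- x) = p_exponential_density p x"
  by (simp add: p_exponential_density_def)

text \<open>The exponential of the preceding power inequality; both sides carry the same factor
  1/Z^2 for the normalising constant Z.\<close>

lemma p_exponential_density_shift:
  assumes p: "0 < p" "p \<le> 2"
  shows "(exp (- (\<bar>c\<bar> powr p / p)) * p_exponential_density p x)\<^sup>2
       \<le> p_exponential_density p (x + c) * p_exponential_density p (x - c)"
proof -
  define Z where "Z = (LINT y|lborel. exp (- (\<bar>y\<bar> powr p / p)))"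
  have "(exp (- (\<bar>c\<bar> powr p / p)) * exp (- (\<bar>x\<bar> powr p / p)))\<^sup>2
      = exp (- ((2 * \<bar>x\<bar> powr p + 2 * \<bar>c\<bar> powr p) / p))"
    by (simp add: power2_eq_square exp_add[symmetric] add_divide_distrib)
  also have "\<dots> \<le> exp (- ((\<bar>x + c\<bar> powr p + \<bar>x - c\<bar> powr p) / p))"
    using powr_add_diff_le[OF p, of x c] p by (simp add: divide_right_mono)
  also have "\<dots> = exp (- (\<bar>x + c\<bar> powr p / p)) * exp (- (\<bar>x - c\<bar> powr p / p))"
    by (simp add: exp_add[symmetric] add_divide_distrib)
  finally have "(exp (- (\<bar>c\<bar> powr p / p)) * exp (- (\<bar>x\<bar> powr p / p)))\<^sup>2 / Z\<^sup>2
      \<le> exp (- (\<bar>x + c\<bar> powr p / p)) * exp (- (\<bar>x - c\<bar> powr p / p)) / Z\<^sup>2"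
    by (rule divide_right_mono) simp
  then show ?thesis
    unfolding p_exponential_density_def Z_def[symmetric]
    by (simp add: power2_eq_square field_simps)
qed

text \<open>Only translations and reflections occur, so \<open>s\<close> is its own inverse and the
  Jacobian is 1.\<close>

lemma (in prob_space) distributed_lborel_affine:
  fixes X :: "'a \<Rightarrow> real"
  assumes X: "distributed M lborel X (\<lambda>x. ennreal (f x))" and s: "s = 1 \<or> s = - 1"
  shows "distributed M lborel (\<lambda>\<omega>. s * X \<omega> + t) (\<lambda>x. ennreal (f (s * (x - t))))"
proof -
  have "distributed M lborel (\<lambda>\<omega>. t + s * X \<omega>) (\<lambda>x. ennreal (f ((x - t) / s)) / \<bar>s\<bar>)"
    using X s by (intro distributed_affine) auto
  moreover have "(\<lambda>x. ennreal (f ((x - t) / s)) / \<bar>s\<bar>) = (\<lambda>x. ennreal (f (s * (x - t))))"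
    using s by (auto simp: fun_eq_iff divide_ennreal_def)
  ultimately show ?thesis by (simp add: add.commute)
qed

text \<open>The shifts by \<open>c\<close> and \<open>- c\<close> give the same value for even \<open>F\<close>, so the product of densities may
  be replaced by the mean over both shifts, which the geometric mean bounds from below.\<close>

lemma (in prob_space) p_exponential_shift_lower_bound:
  fixes X :: "'i \<Rightarrow> 'a \<Rightarrow> real"
  assumes p: "0 < p" "p \<le> 2"
    and I: "finite I" "I \<noteq> {}"
    and ind: "indep_vars (\<lambda>_. borel) X I"
    and X: "\<And>i. i \<in> I \<Longrightarrow> distributed M lborel (X i) (\<lambda>x. ennreal (p_exponential_density p x))"
    and F[measurable]: "F \<in> borel_measurable (Pi\<^sub>M I (\<lambda>_. borel))"
    and even: "\<And>x. F (\<lambda>i\<in>I. - x i) = F (\<lambda>i\<in>I. x i)"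
  shows "ennreal (exp (- (\<Sum>i\<in>I. \<bar>c i\<bar> powr p / p))) * (\<integral>\<^sup>+\<omega>. F (\<lambda>i\<in>I. X i \<omega>) \<partial>M)
       \<le> (\<integral>\<^sup>+\<omega>. F (\<lambda>i\<in>I. X i \<omega> - c i) \<partial>M)"
proof -
  let ?\<rho> = "p_exponential_density p"
  let ?L = "Pi\<^sub>M I (\<lambda>_. lborel :: real measure)"
  let ?e = "exp (- (\<Sum>i\<in>I. \<bar>c i\<bar> powr p / p))"
  have sets_eq: "sets ?L = sets (Pi\<^sub>M I (\<lambda>_. borel :: real measure))"
    by (intro sets_PiM_cong) auto
  have FL[measurable]: "F \<in> borel_measurable ?L"
    using F by (simp add: measurable_cong_sets[OF sets_eq refl])
  have \<rho>m[measurable]: "?\<rho> \<in> borel_measurable borel"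
    unfolding p_exponential_density_def by measurable
  have prodm: "(\<lambda>x. \<Prod>i\<in>I. ennreal (?\<rho> (s * (x i - t i)))) \<in> borel_measurable ?L" for s t
    by measurable
  have *: "(\<integral>\<^sup>+\<omega>. F (\<lambda>i\<in>I. s * X i \<omega> + t i) \<partial>M)
      = (\<integral>\<^sup>+x. (\<Prod>i\<in>I. ennreal (?\<rho> (s * (x i - t i)))) * F x \<partial>?L)"
    if s: "s = 1 \<or> s = - 1" for s t
  proof (rule nn_integral_indep_density[OF I _ _ F])
    show "indep_vars (\<lambda>_. borel) (\<lambda>i \<omega>. s * X i \<omega> + t i) I"
      by (rule indep_vars_compose2[OF ind, where Y="\<lambda>i x. s * x + t i"]) measurable
    show "distributed M lborel (\<lambda>\<omega>. s * X i \<omega> + t i) (\<lambda>x. ennreal (?\<rho> (s * (x - t i))))"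
      if "i \<in> I" for i
      by (rule distributed_lborel_affine[OF X[OF that] s])
  qed
  have e0: "(\<integral>\<^sup>+\<omega>. F (\<lambda>i\<in>I. X i \<omega>) \<partial>M) = (\<integral>\<^sup>+x. (\<Prod>i\<in>I. ennreal (?\<rho> (x i))) * F x \<partial>?L)"
    using *[of 1 "\<lambda>_. 0"] by simp
  have e1: "(\<integral>\<^sup>+\<omega>. F (\<lambda>i\<in>I. X i \<omega> - c i) \<partial>M)
      = (\<integral>\<^sup>+x. (\<Prod>i\<in>I. ennreal (?\<rho> (x i + c i))) * F x \<partial>?L)"
    using *[of 1 "\<lambda>i. - c i"] by simp
  \<comment> \<open>Since \<open>F\<close> is even, \<open>X\<close> shifted by \<open>- c\<close>
    may be replaced by \<open>- X\<close> shifted by \<open>c\<close>. The density is even too, so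
    this gives a second formula for the same integral, with the opposite shift in the
    density.\<close>
  have "(\<lambda>i\<in>I. - X i \<omega> + c i) = (\<lambda>i\<in>I. - (X i \<omega> - c i))" for \<omega>
    by auto
  then have "(\<integral>\<^sup>+\<omega>. F (\<lambda>i\<in>I. X i \<omega> - c i) \<partial>M) = (\<integral>\<^sup>+\<omega>. F (\<lambda>i\<in>I. - X i \<omega> + c i) \<partial>M)"
    using even[of "\<lambda>i. X i _ - c i"] by presburger
  also have "\<dots> = (\<integral>\<^sup>+x. (\<Prod>i\<in>I. ennreal (?\<rho> (- (x i - c i)))) * F x \<partial>?L)"
    using *[of "- 1" c] by simp
  also have "\<dots> = (\<integral>\<^sup>+x. (\<Prod>i\<in>I. ennreal (?\<rho> (x i - c i))) * F x \<partial>?L)"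
    unfolding p_exponential_density_minus ..
  finally have e2: "(\<integral>\<^sup>+\<omega>. F (\<lambda>i\<in>I. X i \<omega> - c i) \<partial>M)
      = (\<integral>\<^sup>+x. (\<Prod>i\<in>I. ennreal (?\<rho> (x i - c i))) * F x \<partial>?L)" .
  have pw: "2 * (ennreal ?e * (\<Prod>i\<in>I. ennreal (?\<rho> (x i))))
      \<le> (\<Prod>i\<in>I. ennreal (?\<rho> (x i + c i))) + (\<Prod>i\<in>I. ennreal (?\<rho> (x i - c i)))" for x
  proof -
    define A where "A = (\<Prod>i\<in>I. ?\<rho> (x i + c i))"
    define B where "B = (\<Prod>i\<in>I. ?\<rho> (x i - c i))"
    define D where "D = (\<Prod>i\<in>I. ?\<rho> (x i))"
    have nn: "0 \<le> A" "0 \<le> B" "0 \<le> D"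
      by (auto simp: A_def B_def D_def intro!: prod_nonneg p_exponential_density_nonneg)
    have "(?e * D)\<^sup>2 = (\<Prod>i\<in>I. (exp (- (\<bar>c i\<bar> powr p / p)) * ?\<rho> (x i))\<^sup>2)"
      using I by (simp add: D_def exp_sum sum_negf[symmetric] prod.distrib prod_power_distrib[symmetric] power_mult_distrib)
    also have "\<dots> \<le> (\<Prod>i\<in>I. ?\<rho> (x i + c i) * ?\<rho> (x i - c i))"
      by (intro prod_mono conjI p_exponential_density_shift p) auto
    also have "\<dots> = A * B" by (simp add: A_def B_def prod.distrib)
    finally have "4 * (?e * D)\<^sup>2 \<le> (A + B)\<^sup>2"
      using zero_le_power2[of "A - B"] by (simp add: power2_eq_square algebra_simps)
    then have "(2 * (?e * D))\<^sup>2 \<le> (A + B)\<^sup>2" by (simp add: power_mult_distrib)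
    then have "2 * (?e * D) \<le> A + B" by (rule power2_le_imp_le) (use nn in simp)
    then have "ennreal (2 * (?e * D)) \<le> ennreal (A + B)" by (rule ennreal_leI)
    then show ?thesis
      using nn by (simp add: A_def B_def D_def prod_ennreal p_exponential_density_nonneg ennreal_mult ennreal_plus[symmetric] del: ennreal_plus)
  qed
  have "2 * (ennreal ?e * (\<integral>\<^sup>+\<omega>. F (\<lambda>i\<in>I. X i \<omega>) \<partial>M))
      = (\<integral>\<^sup>+x. 2 * (ennreal ?e * (\<Prod>i\<in>I. ennreal (?\<rho> (x i)))) * F x \<partial>?L)"
    unfolding e0 by (simp add: nn_integral_cmult mult.assoc)
  also have "\<dots> \<le> (\<integral>\<^sup>+x. ((\<Prod>i\<in>I. ennreal (?\<rho> (x i + c i))) + (\<Prod>i\<in>I. ennreal (?\<rho> (x i - c i)))) * F x \<partial>?L)"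
    by (intro nn_integral_mono mult_right_mono pw) auto
  also have "\<dots> = 2 * (\<integral>\<^sup>+\<omega>. F (\<lambda>i\<in>I. X i \<omega> - c i) \<partial>M)"
    by (simp add: distrib_right nn_integral_add e1[symmetric] e2[symmetric] mult_2)
  finally show ?thesis
    by (simp add: ennreal_mult_le_mult_iff)
qed

text \<open>The space is not assumed second countable, so Borel measurability of the vector-valued
  sum is not at hand. Its norm is the square root of a quadratic form in the coordinates.\<close>

lemma norm_sum_scaleR_measurable:
  fixes v :: "'i \<Rightarrow> 'x::real_inner"
  shows "(\<lambda>x. norm (\<Sum>i\<in>I. (g i * x i) *\<^sub>R v i)) \<in> borel_measurable (Pi\<^sub>M I (\<lambda>_. borel))"
proof -
  have "(\<lambda>x. norm (\<Sum>i\<in>I. (g i * x i) *\<^sub>R v i))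
      = (\<lambda>x. sqrt (\<Sum>i\<in>I. \<Sum>j\<in>I. (g i * x i) * ((g j * x j) * inner (v j) (v i))))"
    by (simp add: norm_eq_sqrt_inner inner_sum_left inner_sum_right sum_distrib_left)
  also have "\<dots> \<in> borel_measurable (Pi\<^sub>M I (\<lambda>_. borel))"
    by measurable
  finally show ?thesis .
qed

lemma schauder_basis_sums:
  assumes "schauder_basis \<psi>"
  shows "(\<lambda>l. basis_coeff \<psi> x l *\<^sub>R \<psi> l) sums x"
proof -
  have "\<exists>!a. (\<lambda>l. a l *\<^sub>R \<psi> l) sums x"
    using assms by (simp add: schauder_basis_def)
  from theI'[OF this] show ?thesis by (simp add: basis_coeff_def)
qed

text \<open>A continuous cutoff instead of an indicator lets the bound for the partial sums of the series
  pass to the limit.\<close>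

lemma p_exponential_shifted_ball:
  fixes W :: "'a \<Rightarrow> 'x::real_inner"
  assumes p: "0 < p" "p \<le> 2"
    and W: "p_exponential_element p \<gamma> \<psi> M W"
    and h: "h \<in> Z_space p \<gamma> \<psi>"
    and \<epsilon>: "0 < \<epsilon>"
  shows "exp (- (1 / p * Z_norm_pow p \<gamma> \<psi> h)) * measure M {\<omega> \<in> space M. norm (W \<omega>) \<le> \<epsilon>}
       \<le> measure M {\<omega> \<in> space M. norm (W \<omega> - h) \<le> 2 * \<epsilon>}"
proof -
  interpret prob_space M using W by (simp add: p_exponential_element_def)
  have basis: "schauder_basis \<psi>" and \<gamma>: "\<And>l. 0 < \<gamma> l"
    and Wm[measurable]: "W \<in> borel_measurable M"
    using W by (auto simp: p_exponential_element_def)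
  obtain \<xi> where ind: "indep_vars (\<lambda>_. borel) \<xi> (UNIV :: nat set)"
    and \<xi>: "\<And>l. distributed M lborel (\<xi> l) (\<lambda>x. ennreal (p_exponential_density p x))"
    and conv: "AE \<omega> in M. (\<lambda>l. (\<gamma> l * \<xi> l \<omega>) *\<^sub>R \<psi> l) sums W \<omega>"
    using W by (auto simp: p_exponential_element_def)
  have \<xi>m[measurable]: "\<xi> l \<in> borel_measurable M" for l
    using \<xi>[of l] by (auto simp: distributed_def)
  define a where "a = basis_coeff \<psi> h"
  \<comment> \<open>The shift by \<open>h\<close> in units of the coordinates \<xi>: the p-th powers
    of \<open>c\<close> sum to exactly \<open>Z_norm_pow\<close>.\<close>
  define c where "c l = a l / \<gamma> l" for l
  have a: "(\<lambda>l. a l *\<^sub>R \<psi> l) sums h"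
    unfolding a_def by (rule schauder_basis_sums[OF basis])
  have cp: "\<bar>c l\<bar> powr p = \<bar>a l\<bar> powr p * \<gamma> l powr (- p)" for l
    using \<gamma>[of l] by (simp add: c_def powr_divide powr_minus_divide)
  have csum: "(\<Sum>l<m. \<bar>c l\<bar> powr p / p) \<le> 1 / p * Z_norm_pow p \<gamma> \<psi> h" for m
  proof -
    have "(\<Sum>l<m. \<bar>c l\<bar> powr p) \<le> Z_norm_pow p \<gamma> \<psi> h"
      unfolding Z_norm_pow_def cp a_def using h by (intro sum_le_suminf) (auto simp: Z_space_def)
    then show ?thesis using p by (simp add: sum_divide_distrib[symmetric] divide_right_mono)
  qed
  \<comment> \<open>Equal to 1 up to \<epsilon> and to 0 from 2\<epsilon> on; this transition zone
    is why the radius doubles.\<close>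
  define f where "f r = max 0 (min 1 (2 - r / \<epsilon>))" for r :: real
  have f0: "0 \<le> f r" and f1: "f r \<le> 1" for r by (auto simp: f_def)
  have fcont: "continuous_on UNIV f"
    unfolding f_def using \<epsilon> by (intro continuous_intros) auto
  have fm[measurable]: "f \<in> borel_measurable borel"
    by (rule borel_measurable_continuous_onI[OF fcont])
  have flim: "(\<lambda>n. ennreal (f (r n))) \<longlonglongrightarrow> ennreal (f s)" if "r \<longlonglongrightarrow> s" for r s
    using continuous_on_tendsto_compose[OF fcont that] by (intro tendsto_ennrealI) auto
  define S where "S m \<omega> = (\<Sum>l<m. (\<gamma> l * \<xi> l \<omega>) *\<^sub>R \<psi> l)" for m \<omega>
  define H where "H m = (\<Sum>l<m. a l *\<^sub>R \<psi> l)" for m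
  define F where "F m x = ennreal (f (norm (\<Sum>l<m. (\<gamma> l * x l) *\<^sub>R \<psi> l)))" for m and x :: "nat \<Rightarrow> real"
  have Fm[measurable]: "F m \<in> borel_measurable (Pi\<^sub>M {..<m} (\<lambda>_. borel))" for m
    unfolding F_def by (intro measurable_compose[OF norm_sum_scaleR_measurable]) simp
  have FS: "F m (\<lambda>l\<in>{..<m}. \<xi> l \<omega>) = ennreal (f (norm (S m \<omega>)))" for m \<omega>
    by (simp add: F_def S_def)
  have FH: "F m (\<lambda>l\<in>{..<m}. \<xi> l \<omega> - c l) = ennreal (f (norm (S m \<omega> - H m)))" for m \<omega>
  proof -
    have "(\<gamma> l * (\<xi> l \<omega> - c l)) *\<^sub>R \<psi> l = (\<gamma> l * \<xi> l \<omega>) *\<^sub>R \<psi> l - a l *\<^sub>R \<psi> l" for l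
      using \<gamma>[of l] by (simp add: c_def algebra_simps)
    then show ?thesis by (simp add: F_def S_def H_def sum_subtractf)
  qed
  have Sm: "(\<lambda>\<omega>. ennreal (f (norm (S m \<omega>)))) \<in> borel_measurable M"
    "(\<lambda>\<omega>. ennreal (f (norm (S m \<omega> - H m)))) \<in> borel_measurable M" for m
    unfolding FS[symmetric] FH[symmetric] by measurable
  have Nm[measurable]: "(\<lambda>\<omega>. norm (W \<omega> - x)) \<in> borel_measurable M" for x
    by (rule measurable_compose[OF Wm], rule borel_measurable_continuous_onI)
      (intro continuous_intros)
  have Nm0[measurable]: "(\<lambda>\<omega>. norm (W \<omega>)) \<in> borel_measurable M"
    using Nm[of 0] by simp
  let ?e = "ennreal (exp (- (1 / p * Z_norm_pow p \<gamma> \<psi> h)))"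
  have ineq: "?e * (\<integral>\<^sup>+\<omega>. ennreal (f (norm (S m \<omega>))) \<partial>M) \<le> (\<integral>\<^sup>+\<omega>. ennreal (f (norm (S m \<omega> - H m))) \<partial>M)"
    if m: "0 < m" for m
  proof -
    have "?e * (\<integral>\<^sup>+\<omega>. F m (\<lambda>l\<in>{..<m}. \<xi> l \<omega>) \<partial>M)
        \<le> ennreal (exp (- (\<Sum>l<m. \<bar>c l\<bar> powr p / p))) * (\<integral>\<^sup>+\<omega>. F m (\<lambda>l\<in>{..<m}. \<xi> l \<omega>) \<partial>M)"
      using csum[of m] by (intro mult_right_mono ennreal_leI) auto
    also have "\<dots> \<le> (\<integral>\<^sup>+\<omega>. F m (\<lambda>l\<in>{..<m}. \<xi> l \<omega> - c l) \<partial>M)"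
    proof (rule p_exponential_shift_lower_bound[OF p])
      show "indep_vars (\<lambda>_. borel) \<xi> {..<m}" by (rule indep_vars_subset[OF ind]) auto
      show "F m (\<lambda>i\<in>{..<m}. - x i) = F m (\<lambda>i\<in>{..<m}. x i)" for x
        by (simp add: F_def sum_negf)
    qed (use m \<xi> Fm in auto)
    finally show ?thesis unfolding FS FH .
  qed
  have Slim: "AE \<omega> in M. (\<lambda>m. S m \<omega>) \<longlonglongrightarrow> W \<omega>"
    using conv by eventually_elim (simp add: S_def sums_def)
  have Hlim: "H \<longlonglongrightarrow> h" using a by (simp add: H_def[abs_def] sums_def)
  have l1: "(\<lambda>m. \<integral>\<^sup>+\<omega>. ennreal (f (norm (S m \<omega>))) \<partial>M) \<longlonglongrightarrow> (\<integral>\<^sup>+\<omega>. ennreal (f (norm (W \<omega>))) \<partial>M)"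
  proof (rule nn_integral_dominated_convergence[where w="\<lambda>_. 1"])
    show "AE \<omega> in M. (\<lambda>m. ennreal (f (norm (S m \<omega>)))) \<longlonglongrightarrow> ennreal (f (norm (W \<omega>)))"
      using Slim by eventually_elim (intro flim tendsto_norm)
  qed (use Sm f1 in \<open>auto simp: emeasure_space_1\<close>)
  have l2: "(\<lambda>m. \<integral>\<^sup>+\<omega>. ennreal (f (norm (S m \<omega> - H m))) \<partial>M) \<longlonglongrightarrow> (\<integral>\<^sup>+\<omega>. ennreal (f (norm (W \<omega> - h))) \<partial>M)"
  proof (rule nn_integral_dominated_convergence[where w="\<lambda>_. 1"])
    show "AE \<omega> in M. (\<lambda>m. ennreal (f (norm (S m \<omega> - H m)))) \<longlonglongrightarrow> ennreal (f (norm (W \<omega> - h)))"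
      using Slim by eventually_elim (intro flim tendsto_norm tendsto_diff Hlim)
  qed (use Sm f1 in \<open>auto simp: emeasure_space_1\<close>)
  have main: "?e * (\<integral>\<^sup>+\<omega>. ennreal (f (norm (W \<omega>))) \<partial>M) \<le> (\<integral>\<^sup>+\<omega>. ennreal (f (norm (W \<omega> - h))) \<partial>M)"
  proof (rule LIMSEQ_le[OF ennreal_tendsto_cmult[OF _ l1] l2])
    show "\<exists>N. \<forall>m\<ge>N. ?e * (\<integral>\<^sup>+\<omega>. ennreal (f (norm (S m \<omega>))) \<partial>M)
        \<le> (\<integral>\<^sup>+\<omega>. ennreal (f (norm (S m \<omega> - H m))) \<partial>M)"
      using ineq by (intro exI[of _ 1]) auto
  qed simp
  have lo: "emeasure M {\<omega> \<in> space M. norm (W \<omega>) \<le> \<epsilon>} \<le> (\<integral>\<^sup>+\<omega>. ennreal (f (norm (W \<omega>))) \<partial>M)"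
  proof -
    have "emeasure M {\<omega> \<in> space M. norm (W \<omega>) \<le> \<epsilon>}
        = (\<integral>\<^sup>+\<omega>. indicator {\<omega> \<in> space M. norm (W \<omega>) \<le> \<epsilon>} \<omega> \<partial>M)" by simp
    also have "\<dots> \<le> (\<integral>\<^sup>+\<omega>. ennreal (f (norm (W \<omega>))) \<partial>M)"
      using \<epsilon> by (intro nn_integral_mono) (auto simp: indicator_def f_def min_def field_simps)
    finally show ?thesis .
  qed
  have hi: "(\<integral>\<^sup>+\<omega>. ennreal (f (norm (W \<omega> - h))) \<partial>M) \<le> emeasure M {\<omega> \<in> space M. norm (W \<omega> - h) \<le> 2 * \<epsilon>}"
  proof -
    have "(\<integral>\<^sup>+\<omega>. ennreal (f (norm (W \<omega> - h))) \<partial>M)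
        \<le> (\<integral>\<^sup>+\<omega>. indicator {\<omega> \<in> space M. norm (W \<omega> - h) \<le> 2 * \<epsilon>} \<omega> \<partial>M)"
      using \<epsilon> by (intro nn_integral_mono) (auto simp: indicator_def f_def max_def min_def field_simps)
    also have "\<dots> = emeasure M {\<omega> \<in> space M. norm (W \<omega> - h) \<le> 2 * \<epsilon>}" by simp
    finally show ?thesis .
  qed
  have "?e * emeasure M {\<omega> \<in> space M. norm (W \<omega>) \<le> \<epsilon>}
      \<le> emeasure M {\<omega> \<in> space M. norm (W \<omega> - h) \<le> 2 * \<epsilon>}"
    using mult_left_mono[OF lo, of ?e] main hi by auto
  then show ?thesis
    by (simp add: emeasure_eq_measure ennreal_mult[symmetric])
qed

text \<open>Expansions in a Schauder basis are unique, so \<open>W \<omega> = 0\<close> forces the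
  coordinate \<open>\<xi> 0\<close> to vanish, which has probability zero because it has a
  density.\<close>

lemma p_exponential_nonatomic_zero:
  fixes W :: "'a \<Rightarrow> 'x::real_normed_vector"
  assumes W: "p_exponential_element p \<gamma> \<psi> M W"
  shows "measure M {\<omega> \<in> space M. W \<omega> = 0} = 0"
proof -
  interpret prob_space M using W by (simp add: p_exponential_element_def)
  obtain \<xi> where \<xi>: "distributed M lborel (\<xi> (0::nat)) (\<lambda>x. ennreal (p_exponential_density p x))"
    and conv: "AE \<omega> in M. (\<lambda>l. (\<gamma> l * \<xi> l \<omega>) *\<^sub>R \<psi> l) sums W \<omega>"
    using W by (auto simp: p_exponential_element_def)
  have \<gamma>: "0 < \<gamma> 0" and basis: "schauder_basis \<psi>"
    using W by (auto simp: p_exponential_element_def)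
  have uniq: "a = b" if "(\<lambda>l. a l *\<^sub>R \<psi> l) sums x" "(\<lambda>l. b l *\<^sub>R \<psi> l) sums x" for a b x
    using basis that unfolding schauder_basis_def by blast
  have ne: "AE \<omega> in M. \<xi> 0 \<omega> \<noteq> 0"
  proof -
    have "(AE \<omega> in M. \<xi> 0 \<omega> \<noteq> 0) \<longleftrightarrow> (AE x in lborel. 0 < ennreal (p_exponential_density p x) \<longrightarrow> x \<noteq> 0)"
      by (rule distributed_AE2[OF \<xi>]) measurable
    moreover have "AE x in lborel. x \<noteq> (0::real)" by (rule AE_lborel_singleton)
    ultimately show ?thesis by auto
  qed
  have "AE \<omega> in M. \<not> W \<omega> = 0"
    using conv ne
  proof eventually_elim
    case (elim \<omega>)
    show ?case
    proof
      assume "W \<omega> = 0"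
      with elim(1) have "(\<lambda>l. \<gamma> l * \<xi> l \<omega>) = (\<lambda>_. 0)"
        by (intro uniq[of _ 0]) auto
      then have "\<gamma> 0 * \<xi> 0 \<omega> = 0" by meson
      with elim(2) \<gamma> show False by simp
    qed
  qed
  moreover have "{\<omega> \<in> space M. W \<omega> = 0} \<in> sets M"
  proof -
    have "W -` {0} \<inter> space M \<in> sets M"
      using W by (intro measurable_sets[of W M borel]) (auto simp: p_exponential_element_def)
    also have "W -` {0} \<inter> space M = {\<omega> \<in> space M. W \<omega> = 0}" by auto
    finally show ?thesis .
  qed
  ultimately show ?thesis by (subst prob_eq_0) auto
qed

section \<open>Step functions in L2\<close>

lemma lebesgue_on01_borel_measurable:
  "f \<in> borel_measurable borel \<Longrightarrow> f \<in> borel_measurable (lebesgue_on {0..1})" for f :: "real \<Rightarrow> real"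
  by (intro measurable_restrict_space1 measurable_completion) simp

lemma square_integrable01_bounded:
  assumes "f \<in> borel_measurable (lebesgue_on {0..1})" "\<And>x. x \<in> {0..1} \<Longrightarrow> \<bar>f x\<bar> \<le> K"
  shows "square_integrable01 f"
proof -
  interpret finite_measure "lebesgue_on {0..1::real}"
    by (rule finite_measure_lebesgue_on) simp
  have "integrable (lebesgue_on {0..1}) (\<lambda>x. (f x)\<^sup>2)"
  proof (rule integrable_const_bound[where B="K\<^sup>2"])
    show "AE x in lebesgue_on {0..1}. norm ((f x)\<^sup>2) \<le> K\<^sup>2"
      using assms(2) by (intro AE_I2) (auto intro!: abs_le_square_iff[THEN iffD1] simp: order.trans[OF _ abs_ge_self])
  qed (use assms in measurable)
  with assms show ?thesis by (simp add: square_integrable01_def)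
qed

text \<open>Pairing with these vectors evaluates the primitive of a signal, and on [0,1] their Gram
  matrix is min s t, the covariance of Brownian motion. Questions about path increments thereby
  become Hilbert space geometry.\<close>

lift_definition unit_step :: "real \<Rightarrow> L2" is "\<lambda>t. indicat_real {0..t}"
  by (auto simp: L2_rel_def indicator_def
      intro!: square_integrable01_bounded[where K=1] lebesgue_on01_borel_measurable)

lemma L2_primitive_eq_inner: "L2_primitive w t = inner (unit_step t) w"
  by transfer (simp add: set_lebesgue_integral_def)

lemma inner_unit_step:
  assumes "s \<in> {0..1}" "t \<in> {0..1}"
  shows "inner (unit_step s) (unit_step t) = min s t"
proof -
  have "inner (unit_step s) (unit_step t)
      = (LINT x|lebesgue_on {0..1}. indicat_real {0..s} x * indicat_real {0..t} x)"
    by transfer simp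
  also have "\<dots> = (LINT x|lebesgue_on {0..1}. indicat_real {0..min s t} x)"
    by (intro Bochner_Integration.integral_cong) (auto simp: indicator_def)
  also have "\<dots> = measure (lebesgue_on {0..1}) {0..min s t}"
    using assms by (simp add: min_def Int_absorb2)
  also have "\<dots> = min s t"
    using assms by (simp add: measure_restrict_space min_def)
  finally show ?thesis .
qed

lemma L2_cases_rep:
  obtains f where "square_integrable01 f" "w = abs_L2 f"
proof -
  have "\<exists>f. square_integrable01 f \<and> w = abs_L2 f"
    by (induct w rule: L2.abs_induct) (auto simp: L2_rel_def)
  then show thesis using that by blast
qed

lemma L2_rel_refl: "L2_rel f f \<longleftrightarrow> square_integrable01 f"
  by (auto simp: L2_rel_def)

lemma abs_L2_add:
  assumes "square_integrable01 f" "square_integrable01 g"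
  shows "abs_L2 (\<lambda>x. f x + g x) = abs_L2 f + abs_L2 g"
  using assms by (simp add: plus_L2.abs_eq L2_rel_refl)

lemma abs_L2_scaleR:
  assumes "square_integrable01 f"
  shows "abs_L2 (\<lambda>x. c * f x) = c *\<^sub>R abs_L2 f"
  using assms by (simp add: scaleR_L2.abs_eq L2_rel_refl)

lemma square_integrable01_diff:
  assumes "square_integrable01 f" "square_integrable01 g"
  shows "square_integrable01 (\<lambda>x. f x - g x)"
  using square_integrable01_add[OF assms(1) square_integrable01_scale[OF assms(2), of "- 1"]] by simp

lemma abs_L2_diff:
  assumes "square_integrable01 f" "square_integrable01 g"
  shows "abs_L2 (\<lambda>x. f x - g x) = abs_L2 f - abs_L2 g"
  using abs_L2_add[OF assms(1) square_integrable01_scale[OF assms(2), of "- 1"]]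
    abs_L2_scaleR[OF assms(2), of "- 1"] by simp

lemma norm_abs_L2:
  assumes "square_integrable01 f"
  shows "norm (abs_L2 f) = sqrt (LINT x|lebesgue_on {0..1}. (f x)\<^sup>2)"
  using assms by (simp add: norm_eq_sqrt_inner inner_L2.abs_eq L2_rel_refl power2_eq_square)

lemma unit_step_abs: "unit_step t = abs_L2 (indicat_real {0..t})"
  by (rule unit_step.abs_eq)

lemma square_integrable01_indicator: "square_integrable01 (indicat_real {0..t})"
  using unit_step.rsp[unfolded rel_fun_def, rule_format, of t t] by (simp add: L2_rel_refl)

lemma square_integrable01_sum:
  assumes "\<And>i. i \<in> I \<Longrightarrow> square_integrable01 (f i)"
  shows "square_integrable01 (\<lambda>x. \<Sum>i\<in>I. f i x)"
  using assms
  by (induction I rule: infinite_finite_induct)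
    (auto simp: square_integrable01_zero intro: square_integrable01_add)

lemma abs_L2_sum:
  assumes "\<And>i. i \<in> I \<Longrightarrow> square_integrable01 (f i)"
  shows "abs_L2 (\<lambda>x. \<Sum>i\<in>I. f i x) = (\<Sum>i\<in>I. abs_L2 (f i))"
  using assms
  by (induction I rule: infinite_finite_induct)
    (auto simp: zero_L2.abs_eq[symmetric] zero_L2_def[symmetric] abs_L2_add square_integrable01_sum)

lemma square_integrable01_abs: "square_integrable01 f \<Longrightarrow> square_integrable01 (\<lambda>x. \<bar>f x\<bar>)"
  by (auto simp: square_integrable01_def)

text \<open>Dominated convergence for the squared differences. The dominating function bounds
  \<open>F n - f\<close> rather than \<open>F n\<close>, so that for truncations of an unbounded
  \<open>f\<close> the function \<open>\<bar>f\<bar>\<close> itself can serve.\<close>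

lemma abs_L2_tendsto:
  assumes F: "\<And>n. square_integrable01 (F n)" and f: "square_integrable01 f"
    and G: "square_integrable01 G"
    and lim: "AE x in lebesgue_on {0..1}. (\<lambda>n. F n x) \<longlonglongrightarrow> f x"
    and bound: "\<And>n x. x \<in> {0..1} \<Longrightarrow> \<bar>F n x - f x\<bar> \<le> G x"
  shows "(\<lambda>n. abs_L2 (F n)) \<longlonglongrightarrow> abs_L2 f"
proof -
  have [measurable]: "F n \<in> borel_measurable (lebesgue_on {0..1})"
    "f \<in> borel_measurable (lebesgue_on {0..1})" for n
    using F f by (auto simp: square_integrable01_def)
  have "(\<lambda>n. LINT x|lebesgue_on {0..1}. (F n x - f x)\<^sup>2) \<longlonglongrightarrow> (LINT x|lebesgue_on {0..1::real}. 0)"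
  proof (rule integral_dominated_convergence[where w="\<lambda>x. (G x)\<^sup>2"])
    show "AE x in lebesgue_on {0..1}. (\<lambda>n. (F n x - f x)\<^sup>2) \<longlonglongrightarrow> 0"
      using lim
    proof eventually_elim
      case (elim x)
      have "(\<lambda>n. (F n x - f x)\<^sup>2) \<longlonglongrightarrow> (f x - f x)\<^sup>2"
        by (intro tendsto_intros elim)
      then show ?case by simp
    qed
    show "AE x in lebesgue_on {0..1}. norm ((F n x - f x)\<^sup>2) \<le> (G x)\<^sup>2" for n
      using bound[of _ n] by (intro AE_I2) (auto intro!: abs_le_square_iff[THEN iffD1] simp: order.trans[OF _ abs_ge_self])
  qed (use G in \<open>auto simp: square_integrable01_def\<close>)
  then have "(\<lambda>n. sqrt (LINT x|lebesgue_on {0..1}. (F n x - f x)\<^sup>2)) \<longlonglongrightarrow> sqrt 0"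
    by (intro tendsto_real_sqrt) simp
  moreover have "norm (abs_L2 (F n) - abs_L2 f) = sqrt (LINT x|lebesgue_on {0..1}. (F n x - f x)\<^sup>2)" for n
    unfolding abs_L2_diff[OF F f, symmetric] by (rule norm_abs_L2[OF square_integrable01_diff[OF F f]])
  ultimately have "(\<lambda>n. norm (abs_L2 (F n) - abs_L2 f)) \<longlonglongrightarrow> 0"
    by simp
  then show ?thesis
    by (rule LIM_zero_cancel[OF tendsto_norm_zero_cancel])
qed

lemma closure_limit:
  fixes X :: "nat \<Rightarrow> 'x::metric_space"
  assumes "X \<longlonglongrightarrow> l" "\<And>n. X n \<in> closure S"
  shows "l \<in> closure S"
  using Lim_in_closed_set[OF closed_closure _ _ assms(1)] assms(2) by simp

text \<open>The step function with value \<open>a i\<close> on the cell from i/k (excluded) to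
  (i+1)/k (included). Writing it through \<open>unit_step\<close> makes its pairing with a signal a
  combination of increments of the primitive, which have observable counterparts.\<close>

definition grid_step :: "nat \<Rightarrow> (nat \<Rightarrow> real) \<Rightarrow> L2" where
  "grid_step k a = (\<Sum>i<k. a i *\<^sub>R (unit_step (real (Suc i) / real k) - unit_step (real i / real k)))"

lemma grid_step_value:
  assumes k: "0 < k" and x: "0 < x" "x \<le> 1"
  shows "\<exists>i<k. \<bar>real i / real k - x\<bar> \<le> 1 / real k \<and>
    (\<forall>a. (\<Sum>i<k. a i * (indicat_real {0..real (Suc i) / real k} x - indicat_real {0..real i / real k} x)) = a i)"
proof -
  \<comment> \<open>Cells are open on the left and closed on the right, so the cell of
    \<open>x\<close> is found by rounding up and subtracting one.\<close>
  define i where "i = nat \<lceil>real k * x\<rceil> - 1"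
  have pos: "0 < real k * x" using assms by simp
  then have c: "1 \<le> \<lceil>real k * x\<rceil>" by (simp add: le_ceiling_iff)
  have i: "real i = of_int \<lceil>real k * x\<rceil> - 1"
  proof -
    have "1 \<le> nat \<lceil>real k * x\<rceil>" using c by linarith
    then have "real i = real (nat \<lceil>real k * x\<rceil>) - 1" by (simp add: i_def of_nat_diff)
    then show ?thesis using c by simp
  qed
  have lo: "real i < real k * x" and hi: "real k * x \<le> real (Suc i)"
    using i by linarith+
  have "real k * x \<le> real k" using x k by simp
  with lo have ik: "i < k" by linarith
  have lo': "real i / real k < x" and hi': "x \<le> real (Suc i) / real k"
    using lo hi k by (simp_all add: divide_less_eq le_divide_eq mult.commute)
  have "real (Suc i) / real k = real i / real k + 1 / real k"
    by (simp add: add_divide_distrib)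
  with lo' hi' have d: "\<bar>real i / real k - x\<bar> \<le> 1 / real k" by linarith
  have "(\<Sum>j<k. a j * (indicat_real {0..real (Suc j) / real k} x - indicat_real {0..real j / real k} x))
      = (\<Sum>j\<in>{i}. a j * (indicat_real {0..real (Suc j) / real k} x - indicat_real {0..real j / real k} x))"
    for a
  proof (rule sum.mono_neutral_right)
    show "\<forall>j\<in>{..<k} - {i}. a j * (indicat_real {0..real (Suc j) / real k} x - indicat_real {0..real j / real k} x) = 0"
    proof
      fix j assume j: "j \<in> {..<k} - {i}"
      have mono: "real a / real k \<le> real b / real k" if "a \<le> b" for a b
        using that by (simp add: divide_right_mono)
      from j consider "Suc j \<le> i" | "Suc i \<le> j" by force
      then show "a j * (indicat_real {0..real (Suc j) / real k} x - indicat_real {0..real j / real k} x) = 0"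
      proof cases
        case 1
        with mono[of "Suc j" i] mono[of j i] lo' show ?thesis by (simp add: indicator_def)
      next
        case 2
        with mono[of "Suc i" "Suc j"] mono[of "Suc i" j] hi' x show ?thesis by (simp add: indicator_def)
      qed
    qed
  qed (use ik in auto)
  also have "(\<Sum>j\<in>{i}. a j * (indicat_real {0..real (Suc j) / real k} x - indicat_real {0..real j / real k} x)) = a i" for a
    using lo' hi' x by (simp add: indicator_def)
  finally show ?thesis using ik d by blast
qed

lemma AE_lebesgue_on01: "negligible N \<Longrightarrow> AE x in lebesgue_on {0..1::real}. x \<notin> N"
  by (subst AE_restrict_space_iff) (auto simp: negligible_iff_null_sets intro: AE_not_in[THEN AE_mp])

lemma grid_steps_dense_continuous:
  fixes g :: "real \<Rightarrow> real"
  assumes g: "continuous_on UNIV g" "\<And>x. \<bar>g x\<bar> \<le> K"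
  shows "abs_L2 g \<in> closure {grid_step k a |k a. 0 < k}"
proof -
  define h where "h j x = (\<Sum>i<Suc j. g (real i / real (Suc j)) *
      (indicat_real {0..real (Suc i) / real (Suc j)} x - indicat_real {0..real i / real (Suc j)} x))" for j x
  have K: "0 \<le> K" using g(2)[of 0] by linarith
  have gs: "square_integrable01 g"
    using g by (intro square_integrable01_bounded[where K=K] lebesgue_on01_borel_measurable
        borel_measurable_continuous_onI) auto
  have hs: "square_integrable01 (h j)" for j
    unfolding h_def[abs_def]
    by (intro square_integrable01_sum square_integrable01_scale square_integrable01_diff
        square_integrable01_indicator)
  have h_abs: "abs_L2 (h j) = grid_step (Suc j) (\<lambda>i. g (real i / real (Suc j)))" for j
    unfolding h_def[abs_def] grid_step_def unit_step_abs
    by (simp only: abs_L2_sum square_integrable01_scale square_integrable01_diff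
        square_integrable01_indicator abs_L2_scaleR abs_L2_diff)
  have val: "\<exists>y. \<bar>y - x\<bar> \<le> 1 / real (Suc j) \<and> h j x = g y" if x: "0 < x" "x \<le> 1" for x j
  proof -
    obtain i where "i < Suc j" "\<bar>real i / real (Suc j) - x\<bar> \<le> 1 / real (Suc j)"
      and i: "\<And>a. (\<Sum>i<Suc j. a i * (indicat_real {0..real (Suc i) / real (Suc j)} x
          - indicat_real {0..real i / real (Suc j)} x)) = a i"
      using grid_step_value[OF zero_less_Suc[of j] x] by blast
    then show ?thesis
      using i[of "\<lambda>i. g (real i / real (Suc j))"]
      by (intro exI[of _ "real i / real (Suc j)"]) (simp only: h_def)
  qed
  \<comment> \<open>No cell contains 0, so every step function vanishes there. The point is
    negligible for the limit, but the domination bound is required at it as well.\<close>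
  have h0: "h j 0 = g 0 - g 0" for j
    by (simp add: h_def indicator_def)
  have "(\<lambda>j. abs_L2 (h j)) \<longlonglongrightarrow> abs_L2 g"
  proof (rule abs_L2_tendsto[OF hs gs])
    show "square_integrable01 (\<lambda>x. 2 * K)"
      by (rule square_integrable01_bounded[where K="2 * K"]) (use K in auto)
    show "\<bar>h j x - g x\<bar> \<le> 2 * K" if "x \<in> {0..1}" for j x
    proof (cases "x = 0")
      case True
      then show ?thesis using h0[of j] g(2)[of 0] K by (simp add: abs_le_iff)
    next
      case False
      then obtain y where "h j x = g y" using val[of x j] \<open>x \<in> {0..1}\<close> by auto
      then show ?thesis using g(2)[of x] g(2)[of y] by linarith
    qed
    have "AE x in lebesgue_on {0..1::real}. x \<notin> {0}" by (rule AE_lebesgue_on01) simp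
    then show "AE x in lebesgue_on {0..1}. (\<lambda>j. h j x) \<longlonglongrightarrow> g x"
      using AE_space
    proof eventually_elim
      case (elim x)
      then have x: "0 < x" "x \<le> 1" by auto
      then obtain y where y: "\<And>j. \<bar>y j - x\<bar> \<le> 1 / real (Suc j)" "\<And>j. h j x = g (y j)"
        using val[OF x] by metis
      have "(\<lambda>j. y j - x) \<longlonglongrightarrow> 0"
        using y(1) by (intro Lim_null_comparison[OF _ LIMSEQ_inverse_real_of_nat])
          (auto simp: inverse_eq_divide)
      then have "y \<longlonglongrightarrow> x" by (rule LIM_zero_cancel)
      then show ?case unfolding y(2)
        using continuous_on_tendsto_compose[OF g(1)] by simp
    qed
  qed
  moreover have "abs_L2 (h j) \<in> closure {grid_step k a |k a. 0 < k}" for j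
    by (rule subsetD[OF closure_subset], rule CollectI, intro exI conjI, rule h_abs) simp
  ultimately show ?thesis by (rule closure_limit)
qed

text \<open>A measurable function is almost everywhere a limit of continuous ones; clipping these to
  [-K, K] keeps the limit and supplies a constant dominating function.\<close>

lemma grid_steps_dense_bounded:
  fixes f :: "real \<Rightarrow> real"
  assumes f: "square_integrable01 f" "\<And>x. \<bar>f x\<bar> \<le> K"
  shows "abs_L2 f \<in> closure {grid_step k a |k a. 0 < k}"
proof -
  have K: "0 \<le> K" using f(2)[of 0] by linarith
  have "f measurable_on {0..1}"
    using f(1) by (simp add: square_integrable01_def measurable_on_iff_borel_measurable)
  then obtain N g where N: "negligible N" and g: "\<And>n. continuous_on UNIV (g n)"
    and lim: "\<And>x. x \<notin> N \<Longrightarrow> (\<lambda>n. g n x) \<longlonglongrightarrow> (if x \<in> {0..1} then f x else 0)"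
    unfolding measurable_on_def by blast
  define h where "h n x = max (- K) (min K (g n x))" for n x
  have hc: "continuous_on UNIV (h n)" for n
    unfolding h_def by (intro continuous_intros g)
  have hK: "\<bar>h n x\<bar> \<le> K" for n x using K by (auto simp: h_def)
  have "(\<lambda>n. abs_L2 (h n)) \<longlonglongrightarrow> abs_L2 f"
  proof (rule abs_L2_tendsto[OF _ f(1)])
    show "square_integrable01 (h n)" for n
      using hc hK by (intro square_integrable01_bounded[where K=K] lebesgue_on01_borel_measurable
        borel_measurable_continuous_onI) auto
    show "square_integrable01 (\<lambda>x. 2 * K)"
      by (rule square_integrable01_bounded[where K="2 * K"]) (use K in auto)
    show "\<bar>h n x - f x\<bar> \<le> 2 * K" for n x
      using hK[of n x] f(2)[of x] by linarith
    show "AE x in lebesgue_on {0..1}. (\<lambda>n. h n x) \<longlonglongrightarrow> f x"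
      using AE_lebesgue_on01[OF N] AE_space
    proof eventually_elim
      case (elim x)
      then have "(\<lambda>n. h n x) \<longlonglongrightarrow> max (- K) (min K (f x))"
        unfolding h_def using lim[of x] by (intro tendsto_intros) auto
      also have "max (- K) (min K (f x)) = f x" using f(2)[of x] by (auto simp: abs_le_iff)
      finally show ?case .
    qed
  qed
  moreover have "abs_L2 (h n) \<in> closure {grid_step k a |k a. 0 < k}" for n
    using hc[of n] hK[of n] by (rule grid_steps_dense_continuous)
  ultimately show ?thesis by (rule closure_limit)
qed

lemma grid_steps_dense: "w \<in> closure {grid_step k a |k a. 0 < k}"
proof -
  obtain f where f: "square_integrable01 f" and w: "w = abs_L2 f" by (rule L2_cases_rep[of w])
  define h where "h n x = max (- real n) (min (real n) (f x))" for n x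
  have hK: "\<bar>h n x\<bar> \<le> real n" for n x by (auto simp: h_def)
  have hs: "square_integrable01 (h n)" for n
    unfolding h_def[abs_def]
    by (rule square_integrable01_bounded[where K="real n"]) (use f in \<open>auto simp: square_integrable01_def\<close>)
  have "(\<lambda>n. abs_L2 (h n)) \<longlonglongrightarrow> abs_L2 f"
  proof (rule abs_L2_tendsto[OF hs f f[THEN square_integrable01_abs]])
    show "\<bar>h n x - f x\<bar> \<le> \<bar>f x\<bar>" for n x by (auto simp: h_def)
    show "AE x in lebesgue_on {0..1}. (\<lambda>n. h n x) \<longlonglongrightarrow> f x"
    proof (rule AE_I2)
      fix x
      obtain m :: nat where "\<bar>f x\<bar> \<le> real m" using real_arch_simple by blast
      then have "eventually (\<lambda>n. h n x = f x) sequentially"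
        by (intro eventually_sequentiallyI[of m]) (auto simp: h_def)
      then show "(\<lambda>n. h n x) \<longlonglongrightarrow> f x" by (rule tendsto_eventually)
    qed
  qed
  moreover have "abs_L2 (h n) \<in> closure {grid_step k a |k a. 0 < k}" for n
    using hs[of n] hK[of n] by (rule grid_steps_dense_bounded)
  ultimately show ?thesis unfolding w by (rule closure_limit)
qed

section \<open>Extension from cylinder sets\<close>

text \<open>One set \<open>A\<close> has to approximate \<open>E\<close> under both laws, and
  approximating for each law separately would give unrelated sets. The induction over the generated
  sigma-algebra therefore measures the error by the sum \<open>d\<close> of the two
  measures.\<close>

lemma algebra_approximation:
  assumes G: "algebra \<Omega> G"
    and P: "finite_measure P" "sets P = sigma_sets \<Omega> G"
    and Q: "finite_measure Q" "sets Q = sigma_sets \<Omega> G"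
    and E: "E \<in> sigma_sets \<Omega> G" and e: "0 < e"
  shows "\<exists>A\<in>G. measure P ((E - A) \<union> (A - E)) + measure Q ((E - A) \<union> (A - E)) < e"
proof -
  interpret algebra \<Omega> G by fact
  interpret P: finite_measure P by fact
  interpret Q: finite_measure Q by fact
  define d where "d A = measure P A + measure Q A" for A
  have Gs: "A \<in> sigma_sets \<Omega> G" if "A \<in> G" for A using that by (rule sigma_sets.Basic)
  interpret S: sigma_algebra \<Omega> "sigma_sets \<Omega> G"
    by (rule sigma_algebra_sigma_sets[OF space_closed])
  have d_mono: "d A \<le> d B" if "A \<subseteq> B" "B \<in> sigma_sets \<Omega> G" for A B
    unfolding d_def using that P(2) Q(2) by (intro add_mono P.finite_measure_mono Q.finite_measure_mono) auto
  have d_Un: "d (A \<union> B) \<le> d A + d B" if "A \<in> sigma_sets \<Omega> G" "B \<in> sigma_sets \<Omega> G" for A B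
    using measure_Un_le[of A P B] measure_Un_le[of A Q B] that P(2) Q(2)
    by (simp add: d_def)
  have d_UN: "d (\<Union>i<m. A i) \<le> (\<Sum>i<m. d (A i))" if "\<And>i. A i \<in> sigma_sets \<Omega> G" for A and m :: nat
  proof (induction m)
    case (Suc m)
    have "(\<Union>i<m. A i) \<in> sigma_sets \<Omega> G" using that by auto
    then show ?case using d_Un[of "\<Union>i<m. A i" "A m"] that Suc by (simp add: lessThan_Suc Un_commute)
  qed (simp add: d_def)
  have "\<exists>A\<in>G. d ((E - A) \<union> (A - E)) < e" if "0 < e" for e
    using E that
  proof (induction arbitrary: e rule: sigma_sets.induct)
    case (Basic a)
    then show ?case by (intro bexI[of _ a]) (auto simp: d_def)
  next
    case Empty
    then show ?case by (intro bexI[of _ "{}"]) (auto simp: d_def)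
  next
    case (Compl a)
    then obtain A where A: "A \<in> G" "d ((a - A) \<union> (A - a)) < e" by blast
    have "a \<subseteq> \<Omega>" "A \<subseteq> \<Omega>" using Compl(1) A(1) S.sets_into_space Gs by auto
    then have "((\<Omega> - a) - (\<Omega> - A)) \<union> ((\<Omega> - A) - (\<Omega> - a)) = (a - A) \<union> (A - a)" by auto
    with A show ?case by (intro bexI[of _ "\<Omega> - A"]) auto
  next
    case (Union a)
    \<comment> \<open>Continuity from below reduces the countable union to its first
      \<open>m\<close> members at a cost below e/2. Only finitely many approximants are then
      combined, so their union stays in the algebra and the rest of the error can be shared
      equally.\<close>
    define U where "U m = (\<Union>i<m. a i)" for m :: nat
    have a: "a i \<in> sigma_sets \<Omega> G" for i by fact
    have U: "U m \<in> sigma_sets \<Omega> G" for m unfolding U_def using a by auto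
    have aU: "(\<Union>i. a i) \<in> sigma_sets \<Omega> G" using a by auto
    have UU: "(\<Union>m. U m) = (\<Union>i. a i)" by (auto simp: U_def)
    have incU: "incseq U" by (auto simp: incseq_def U_def intro: order.strict_trans2)
    have "(\<lambda>m. d (U m)) \<longlonglongrightarrow> d (\<Union>i. a i)"
      unfolding d_def UU[symmetric] using U P(2) Q(2) incU
      by (intro tendsto_add P.finite_Lim_measure_incseq Q.finite_Lim_measure_incseq) auto
    then have "eventually (\<lambda>m. d (\<Union>i. a i) - e / 2 < d (U m)) sequentially"
      using \<open>0 < e\<close> by (intro order_tendstoD) auto
    then obtain m where m: "d (\<Union>i. a i) - e / 2 < d (U m)" by (auto simp: eventually_sequentially)
    have "U m \<subseteq> (\<Union>i. a i)" by (auto simp: U_def)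
    then have "d ((\<Union>i. a i) - U m) = d (\<Union>i. a i) - d (U m)"
      using P.finite_measure_Diff[of "\<Union>i. a i" "U m"] Q.finite_measure_Diff[of "\<Union>i. a i" "U m"]
        aU U P(2) Q(2) by (simp add: d_def)
    with m have tail: "d ((\<Union>i. a i) - U m) < e / 2" by simp
    \<comment> \<open>The summand 1 keeps the denominator positive when
      \<open>m = 0\<close>.\<close>
    define e' where "e' = e / (2 * (real m + 1))"
    have "0 < e'" using \<open>0 < e\<close> by (simp add: e'_def)
    then have "\<forall>i. \<exists>A\<in>G. d ((a i - A) \<union> (A - a i)) < e'"
      using Union(2) by blast
    then obtain A where A: "\<And>i. A i \<in> G" "\<And>i. d ((a i - A i) \<union> (A i - a i)) < e'" by metis
    define B where "B = (\<Union>i<m. A i)"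
    have B: "B \<in> G" unfolding B_def using A(1) by auto
    let ?D = "\<lambda>i. (a i - A i) \<union> (A i - a i)"
    have D: "?D i \<in> sigma_sets \<Omega> G" for i
      using a[of i] Gs[OF A(1)[of i]] by (intro S.Un S.Diff)
    have DU: "(\<Union>i<m. ?D i) \<in> sigma_sets \<Omega> G" using D by auto
    have "d (((\<Union>i. a i) - B) \<union> (B - (\<Union>i. a i))) \<le> d (((\<Union>i. a i) - U m) \<union> (\<Union>i<m. ?D i))"
      using aU U DU by (intro d_mono) (auto simp: U_def B_def)
    also have "\<dots> \<le> d ((\<Union>i. a i) - U m) + d (\<Union>i<m. ?D i)"
      using aU U DU by (intro d_Un) auto
    also have "d (\<Union>i<m. ?D i) \<le> (\<Sum>i<m. d (?D i))" by (rule d_UN[OF D])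
    also have "(\<Sum>i<m. d (?D i)) \<le> (\<Sum>i<m. e')" using A(2) by (intro sum_mono less_imp_le)
    also have "(\<Sum>i<m. e') \<le> e / 2"
      using \<open>0 < e\<close> by (simp add: e'_def field_simps)
    also note tail
    finally show ?case using B by (intro bexI[of _ B]) auto
  qed
  from this[OF e] show ?thesis by (simp add: d_def)
qed

text \<open>Replacing \<open>E\<close> by an approximating \<open>A\<close> changes the left side by
  at most e' and the right side by at most b e'. For an affine bound these errors simply add
  up.\<close>

lemma linear_bound_extends_from_algebra:
  fixes b c :: real
  assumes G: "algebra \<Omega> G"
    and P: "finite_measure P" "sets P = sigma_sets \<Omega> G"
    and Q: "finite_measure Q" "sets Q = sigma_sets \<Omega> G"
    and b: "0 \<le> b"
    and le: "\<And>A. A \<in> G \<Longrightarrow> measure P A \<le> b * measure Q A + c"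
    and E: "E \<in> sigma_sets \<Omega> G"
  shows "measure P E \<le> b * measure Q E + c"
proof (rule field_le_epsilon)
  fix e :: real assume "0 < e"
  define e' where "e' = e / (1 + b)"
  have e': "0 < e'" using \<open>0 < e\<close> b by (simp add: e'_def)
  have "e' + b * e' = (1 + b) * e'" by (simp add: algebra_simps)
  also have "\<dots> = e" using b by (simp add: e'_def)
  finally have e'2: "e' + b * e' = e" .
  obtain A where A: "A \<in> G" "measure P ((E - A) \<union> (A - E)) + measure Q ((E - A) \<union> (A - E)) < e'"
    using algebra_approximation[OF G P Q E e'] by blast
  interpret algebra \<Omega> G by fact
  interpret P: finite_measure P by fact
  interpret Q: finite_measure Q by fact
  have As: "A \<in> sigma_sets \<Omega> G" using A(1) by (rule sigma_sets.Basic)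
  interpret S: sigma_algebra \<Omega> "sigma_sets \<Omega> G"
    by (rule sigma_algebra_sigma_sets[OF space_closed])
  have D: "(E - A) \<union> (A - E) \<in> sigma_sets \<Omega> G" using E As by auto
  have "measure P E \<le> measure P (A \<union> ((E - A) \<union> (A - E)))"
    using As D P(2) by (intro P.finite_measure_mono) auto
  also have "\<dots> \<le> measure P A + measure P ((E - A) \<union> (A - E))"
    using As D P(2) by (intro measure_Un_le) auto
  also have "measure P ((E - A) \<union> (A - E)) \<le> e'"
    using A(2) measure_nonneg[of Q "(E - A) \<union> (A - E)"] by linarith
  finally have 1: "measure P E \<le> b * measure Q A + c + e'" using le[OF A(1)] by simp
  have "measure Q A \<le> measure Q (E \<union> ((E - A) \<union> (A - E)))"
    using E D Q(2) by (intro Q.finite_measure_mono) auto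
  also have "\<dots> \<le> measure Q E + measure Q ((E - A) \<union> (A - E))"
    using E D Q(2) by (intro measure_Un_le) auto
  also have "measure Q ((E - A) \<union> (A - E)) \<le> e'"
    using A(2) measure_nonneg[of P "(E - A) \<union> (A - E)"] by linarith
  finally have "b * measure Q A \<le> b * (measure Q E + e')" using b by (intro mult_left_mono) auto
  with 1 show "measure P E \<le> b * measure Q E + c + e" using e'2 by (simp add: algebra_simps)
qed

text \<open>The bases are arbitrary Borel sets rather than boxes, so that the cylinders form an
  algebra. An inequality between measures, unlike an equality, does not pass from an
  intersection-stable generator to the sigma-algebra.\<close>

definition cylinder_sets :: "'i set \<Rightarrow> ('i \<Rightarrow> real) set set" where
  "cylinder_sets I = {prod_emb I (\<lambda>_. borel) J S |J S. finite J \<and> J \<subseteq> I \<and> S \<in> sets (Pi\<^sub>M J (\<lambda>_. borel))}"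

lemma cylinder_setsE:
  assumes "A \<in> cylinder_sets I"
  obtains J S where "finite J" "J \<subseteq> I" "S \<in> sets (Pi\<^sub>M J (\<lambda>_. borel))" "A = prod_emb I (\<lambda>_. borel) J S"
  using assms by (auto simp: cylinder_sets_def)

lemma algebra_cylinder_sets: "algebra (space (Pi\<^sub>M I (\<lambda>_. borel))) (cylinder_sets I)"
  unfolding algebra_iff_Un
proof (intro conjI ballI)
  let ?B = "\<lambda>_::'a. borel :: real measure"
  show "cylinder_sets I \<subseteq> Pow (space (Pi\<^sub>M I ?B))"
    by (auto simp: cylinder_sets_def prod_emb_def space_PiM)
  show "{} \<in> cylinder_sets I"
    by (auto simp: cylinder_sets_def intro!: exI[of _ "{}"])
  show "space (Pi\<^sub>M I ?B) - A \<in> cylinder_sets I" if A: "A \<in> cylinder_sets I" for A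
  proof -
    from A obtain J S where J: "finite J" "J \<subseteq> I" and S: "S \<in> sets (Pi\<^sub>M J ?B)"
      and "A = prod_emb I ?B J S" by (rule cylinder_setsE)
    then have "space (Pi\<^sub>M I ?B) - A = prod_emb I ?B J (space (Pi\<^sub>M J ?B) - S)"
      by (auto simp: prod_emb_def space_PiM)
    with J S show ?thesis
      unfolding cylinder_sets_def
      by (intro CollectI exI[of _ J] exI[of _ "space (Pi\<^sub>M J ?B) - S"]) auto
  qed
  show "A \<union> A' \<in> cylinder_sets I" if A: "A \<in> cylinder_sets I" and A': "A' \<in> cylinder_sets I" for A A'
  proof -
    from A obtain J S where J: "finite J" "J \<subseteq> I" and S: "S \<in> sets (Pi\<^sub>M J ?B)"
      and Aeq: "A = prod_emb I ?B J S" by (rule cylinder_setsE)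
    from A' obtain J' S' where J': "finite J'" "J' \<subseteq> I" and S': "S' \<in> sets (Pi\<^sub>M J' ?B)"
      and A'eq: "A' = prod_emb I ?B J' S'" by (rule cylinder_setsE)
    define K where "K = J \<union> J'"
    define T where "T = prod_emb K ?B J S \<union> prod_emb K ?B J' S'"
    have "T \<in> sets (Pi\<^sub>M K ?B)"
      unfolding T_def K_def using J J' S S' by (intro sets.Un measurable_prod_emb) auto
    moreover have "A \<union> A' = prod_emb I ?B K T"
      unfolding Aeq A'eq T_def using J J'
      by (auto simp: prod_emb_def K_def restrict_restrict Int_absorb1 Int_absorb2)
    ultimately show ?thesis
      unfolding cylinder_sets_def using J J'
      by (intro CollectI exI[of _ K] exI[of _ T]) (auto simp: K_def)
  qed
qed

lemma sets_PiM_eq_cylinder_sets: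
  "sets (Pi\<^sub>M I (\<lambda>_. borel)) = sigma_sets (space (Pi\<^sub>M I (\<lambda>_. borel))) (cylinder_sets I)"
proof (rule antisym)
  let ?B = "\<lambda>_::'a. borel :: real measure"
  show "sigma_sets (space (Pi\<^sub>M I ?B)) (cylinder_sets I) \<subseteq> sets (Pi\<^sub>M I ?B)"
    by (intro sets.sigma_sets_subset) (auto simp: cylinder_sets_def intro: measurable_prod_emb)
  show "sets (Pi\<^sub>M I ?B) \<subseteq> sigma_sets (space (Pi\<^sub>M I ?B)) (cylinder_sets I)"
    unfolding sets_PiM_single space_PiM
  proof (rule sigma_sets_mono')
    show "{{f \<in> \<Pi>\<^sub>E i\<in>I. space (?B i). f i \<in> A} |i A. i \<in> I \<and> A \<in> sets (?B i)} \<subseteq> cylinder_sets I"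
    proof safe
      fix i and A :: "real set" assume i: "i \<in> I" and A: "A \<in> sets borel"
      have "{f \<in> \<Pi>\<^sub>E i\<in>I. space (?B i). f i \<in> A} = prod_emb I ?B {i} (Pi\<^sub>E {i} (\<lambda>_. A))"
        by (auto simp: prod_emb_def PiE_iff extensional_def)
      then show "{f \<in> \<Pi>\<^sub>E i\<in>I. space (?B i). f i \<in> A} \<in> cylinder_sets I"
        unfolding cylinder_sets_def using i A
        by (intro CollectI exI[of _ "{i}"] exI[of _ "Pi\<^sub>E {i} (\<lambda>_. A)"] conjI sets_PiM_I_finite) auto
    qed
  qed
qed

section \<open>Change of measure in the white noise model\<close>

lemma unit_step_0: "unit_step 0 = 0"
  using inner_unit_step[of 0 0] by simp

lemma norm_unit_step_diff:
  assumes "s \<in> {0..1}" "t \<in> {0..1}"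
  shows "(norm (unit_step t - unit_step s))\<^sup>2 = \<bar>t - s\<bar>"
  using assms
  by (simp add: power2_norm_eq_inner inner_diff_left inner_diff_right inner_unit_step min_def)

text \<open>The curve of unit steps is Hoelder continuous of order 1/2, which explains the modulus
  \<open>e\<^sup>2\<close>; the primitive is a continuous linear functional of it.\<close>

lemma continuous_on_L2_primitive: "continuous_on {0..1} (L2_primitive w)"
proof -
  have "continuous_on {0..1} unit_step"
    unfolding continuous_on_iff
  proof (intro ballI allI impI)
    fix s e :: real assume s: "s \<in> {0..1}" and e: "0 < e"
    have "dist (unit_step t) (unit_step s) < e" if "t \<in> {0..1}" "dist t s < e\<^sup>2" for t
    proof -
      have "(norm (unit_step t - unit_step s))\<^sup>2 < e\<^sup>2"
        using that s by (simp add: norm_unit_step_diff dist_real_def)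
      then show ?thesis using e by (simp add: dist_norm power_less_imp_less_base)
    qed
    then show "\<exists>d>0. \<forall>t\<in>{0..1}. dist t s < d \<longrightarrow> dist (unit_step t) (unit_step s) < e"
      using e by (intro exI[of _ "e\<^sup>2"]) auto
  qed
  then show ?thesis
    unfolding L2_primitive_eq_inner[abs_def] by (intro continuous_intros)
qed

locale brownian =
  fixes N :: "'b measure" and B :: "real \<Rightarrow> 'b \<Rightarrow> real"
  assumes bm: "brownian_motion01 N B"
begin

sublocale prob_space N using bm by (simp add: brownian_motion01_def)

lemma B_measurable: "t \<in> {0..1} \<Longrightarrow> B t \<in> borel_measurable N"
  using bm by (simp add: brownian_motion01_def)

definition observation :: "nat \<Rightarrow> L2 \<Rightarrow> real \<Rightarrow> 'b \<Rightarrow> real" where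
  "observation n w t \<omega> = L2_primitive w t + 1 / sqrt (real n) * B t \<omega>"

lemma observation_measurable[measurable]:
  "t \<in> {0..1} \<Longrightarrow> observation n w t \<in> borel_measurable N"
  unfolding observation_def using B_measurable[of t] by measurable

lemma observation_0: "\<omega> \<in> space N \<Longrightarrow> observation n w 0 \<omega> = 0"
  using bm by (simp add: observation_def L2_primitive_eq_inner unit_step_0 brownian_motion01_def)

lemma path_measurable_PiM:
  "(\<lambda>\<omega>. \<lambda>t\<in>{0..1}. observation n w t \<omega>) \<in> measurable N (Pi\<^sub>M {0..1} (\<lambda>_. borel))"
  by (intro measurable_restrict observation_measurable)

lemma path_measurable: "(\<lambda>\<omega>. \<lambda>t\<in>{0..1}. observation n w t \<omega>) \<in> measurable N C01"
  unfolding C01_def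
proof (intro measurable_restrict_space2 path_measurable_PiM Pi_I)
  fix \<omega> assume \<omega>: "\<omega> \<in> space N"
  have "continuous_on {0..1} (\<lambda>t. observation n w t \<omega>)"
    unfolding observation_def using bm \<omega>
    by (intro continuous_intros continuous_on_L2_primitive) (simp add: brownian_motion01_def)
  then show "(\<lambda>t\<in>{0..1}. observation n w t \<omega>) \<in> {x. continuous_on {0..1} x}"
    unfolding mem_Collect_eq by (rule continuous_on_eq) simp
qed

lemma white_noise_law_eq: "white_noise_law N B n w = distr N C01 (\<lambda>\<omega>. \<lambda>t\<in>{0..1}. observation n w t \<omega>)"
  by (simp add: white_noise_law_def observation_def)

lemma prob_space_white_noise_law: "prob_space (white_noise_law N B n w)"
  unfolding white_noise_law_eq by (rule prob_space_distr[OF path_measurable])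

lemma sets_white_noise_law [simp, measurable_cong]: "sets (white_noise_law N B n w) = sets C01"
  by (simp add: white_noise_law_def)

end

text \<open>The pairing with a signal is the drift of the path over one cell. For distinct cells
  these vectors are orthogonal, the counterpart of independent increments.\<close>

definition step_incr :: "(nat \<Rightarrow> real) \<Rightarrow> nat \<Rightarrow> L2" where
  "step_incr \<tau> i = unit_step (\<tau> (Suc i)) - unit_step (\<tau> i)"

lemma inner_step_incr:
  assumes \<tau>: "strict_mono_on {..k} \<tau>" "\<tau> ` {..k} \<subseteq> {0..1}" and ij: "i < k" "j < k"
  shows "inner (step_incr \<tau> i) (step_incr \<tau> j) = (if i = j then \<tau> (Suc i) - \<tau> i else 0)"
proof -
  have r: "\<tau> a \<in> {0..1}" if "a \<le> k" for a using \<tau>(2) that by auto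
  have m: "\<tau> a < \<tau> b" if "a < b" "b \<le> k" for a b
    using strict_mono_onD[OF \<tau>(1), of a b] that by auto
  have mle: "\<tau> a \<le> \<tau> b" if "a \<le> b" "b \<le> k" for a b
    using m[of a b] that by (cases "a = b") auto
  have e: "inner (step_incr \<tau> i) (step_incr \<tau> j)
      = min (\<tau> (Suc i)) (\<tau> (Suc j)) - min (\<tau> (Suc i)) (\<tau> j) - min (\<tau> i) (\<tau> (Suc j)) + min (\<tau> i) (\<tau> j)"
    using ij r[of i] r[of j] r[of "Suc i"] r[of "Suc j"]
    by (simp add: step_incr_def inner_diff_left inner_diff_right inner_unit_step)
  consider "i = j" | "i < j" | "j < i" by linarith
  then show ?thesis
  proof cases
    case 1
    then show ?thesis unfolding e using m[of i "Suc i"] ij by (simp add: min_def)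
  next
    case 2
    then show ?thesis
      using mle[of "Suc i" j] mle[of i j] mle[of "Suc i" "Suc j"] mle[of i "Suc j"] ij
      by (simp add: e min_def)
  next
    case 3
    then show ?thesis
      using mle[of "Suc j" i] mle[of j i] mle[of "Suc j" "Suc i"] mle[of j "Suc i"] ij
      by (simp add: e min_def)
  qed
qed

text \<open>\<open>y\<close> is the orthogonal projection of \<open>d\<close>, and the claim is that
  |d - y|^2 is nonnegative. The family is left unnormalised because its squared lengths, divided by
  n, are the variances of the observed increments.\<close>

lemma bessel_inequality:
  fixes v :: "'i \<Rightarrow> 'x::real_inner"
  assumes I: "finite I"
    and orth: "\<And>i j. i \<in> I \<Longrightarrow> j \<in> I \<Longrightarrow> inner (v i) (v j) = (if i = j then s i else 0)"
    and s: "\<And>i. i \<in> I \<Longrightarrow> 0 < s i"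
  shows "(\<Sum>i\<in>I. (inner (v i) d)\<^sup>2 / s i) \<le> (norm d)\<^sup>2"
proof -
  define y where "y = (\<Sum>i\<in>I. (inner (v i) d / s i) *\<^sub>R v i)"
  have dy: "inner d y = (\<Sum>i\<in>I. (inner (v i) d)\<^sup>2 / s i)"
    by (simp add: y_def inner_sum_right inner_commute power2_eq_square)
  have vy: "inner (v i) y = inner (v i) d" if i: "i \<in> I" for i
  proof -
    have "inner (v i) y = (\<Sum>j\<in>I. if j = i then inner (v j) d else 0)"
      unfolding y_def inner_sum_right inner_scaleR_right
    proof (rule sum.cong)
      fix j assume "j \<in> I"
      then show "inner (v j) d / s j * inner (v i) (v j) = (if j = i then inner (v j) d else 0)"
        using i s[of j] s[of i] by (auto simp: orth)
    qed simp
    then show ?thesis using I i by simp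
  qed
  have "inner y y = (\<Sum>i\<in>I. inner (v i) d / s i * inner (v i) y)"
    by (subst (1) y_def) (simp add: inner_sum_left)
  also have "\<dots> = (\<Sum>i\<in>I. (inner (v i) d)\<^sup>2 / s i)"
    by (intro sum.cong) (simp_all add: vy power2_eq_square)
  finally have yy: "inner y y = (\<Sum>i\<in>I. (inner (v i) d)\<^sup>2 / s i)" .
  have "0 \<le> inner (d - y) (d - y)" by simp
  also have "\<dots> = inner d d - 2 * inner d y + inner y y"
    by (simp add: inner_diff_left inner_diff_right inner_commute)
  finally show ?thesis using dy yy by (simp add: power2_norm_eq_inner)
qed

text \<open>\<open>m\<close> is the midpoint of \<open>m'\<close> and \<open>2 * m - m'\<close>, so
  by the parallelogram identity the two quadratic exponents add up to twice the one at
  \<open>m\<close> plus a constant. This is the Gaussian counterpart of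
  \<open>p_exponential_density_shift\<close>, with equality.\<close>

lemma normal_density_square:
  assumes "0 < \<sigma>"
  shows "(normal_density m \<sigma> x)\<^sup>2
    = exp ((m - m')\<^sup>2 / \<sigma>\<^sup>2) * (normal_density m' \<sigma> x * normal_density (2 * m - m') \<sigma> x)"
proof -
  have sq: "(x - m')\<^sup>2 + (x - (2 * m - m'))\<^sup>2 = 2 * (x - m)\<^sup>2 + 2 * (m - m')\<^sup>2"
    by (simp add: power2_eq_square algebra_simps)
  have "exp (- (x - m)\<^sup>2 / (2 * \<sigma>\<^sup>2)) * exp (- (x - m)\<^sup>2 / (2 * \<sigma>\<^sup>2))
      = exp (- (2 * (x - m)\<^sup>2) / (2 * \<sigma>\<^sup>2))"
    by (simp add: exp_add[symmetric] diff_divide_distrib[symmetric] add_divide_distrib[symmetric] del: exp_add)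
  also have "\<dots> = exp ((m - m')\<^sup>2 / \<sigma>\<^sup>2 + (- ((x - m')\<^sup>2 + (x - (2 * m - m'))\<^sup>2) / (2 * \<sigma>\<^sup>2)))"
    unfolding sq using assms by (simp add: field_simps)
  also have "\<dots> = exp ((m - m')\<^sup>2 / \<sigma>\<^sup>2) * (exp (- (x - m')\<^sup>2 / (2 * \<sigma>\<^sup>2)) * exp (- (x - (2 * m - m'))\<^sup>2 / (2 * \<sigma>\<^sup>2)))"
    unfolding mult_exp_exp by (simp add: add_divide_distrib diff_divide_distrib)
  finally show ?thesis
    by (simp add: normal_density_def power2_eq_square)
qed

context brownian
begin

lemma observation_increment_distributed:
  assumes n: "0 < n" and st: "0 \<le> s" "s < t" "t \<le> 1"
  shows "distributed N lborel (\<lambda>\<omega>. observation n w t \<omega> - observation n w s \<omega>)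
    (\<lambda>x. ennreal (normal_density (inner (unit_step t - unit_step s) w) (sqrt ((t - s) / real n)) x))"
proof -
  have "distributed N lborel (\<lambda>\<omega>. B t \<omega> - B s \<omega>) (\<lambda>x. ennreal (normal_density 0 (sqrt (t - s)) x))"
    using bm st by (simp add: brownian_motion01_def)
  from normal_density_affine[OF this, of "1 / sqrt (real n)" "inner (unit_step t - unit_step s) w"] n st
  have "distributed N lborel (\<lambda>\<omega>. inner (unit_step t - unit_step s) w + 1 / sqrt (real n) * (B t \<omega> - B s \<omega>))
    (\<lambda>x. ennreal (normal_density (inner (unit_step t - unit_step s) w) (sqrt ((t - s) / real n)) x))"
    by (simp add: real_sqrt_divide)
  moreover have "(\<lambda>\<omega>. inner (unit_step t - unit_step s) w + 1 / sqrt (real n) * (B t \<omega> - B s \<omega>))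
      = (\<lambda>\<omega>. observation n w t \<omega> - observation n w s \<omega>)"
    by (simp add: observation_def L2_primitive_eq_inner inner_diff_left right_diff_distrib fun_eq_iff diff_divide_distrib)
  ultimately show ?thesis by simp
qed

lemma observation_increments_indep:
  assumes \<tau>: "strict_mono_on {..k} \<tau>" "\<tau> ` {..k} \<subseteq> {0..1}"
  shows "indep_vars (\<lambda>_. borel) (\<lambda>i \<omega>. observation n w (\<tau> (Suc i)) \<omega> - observation n w (\<tau> i) \<omega>) {..<k}"
proof -
  have "indep_vars (\<lambda>_. borel) (\<lambda>i \<omega>. B (\<tau> (Suc i)) \<omega> - B (\<tau> i) \<omega>) {..<k}"
    using bm \<tau> by (simp add: brownian_motion01_def)
  from indep_vars_compose2[OF this, where
      Y="\<lambda>i x. inner (step_incr \<tau> i) w + 1 / sqrt (real n) * x" and N="\<lambda>_. borel"]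
  have "indep_vars (\<lambda>_. borel) (\<lambda>i \<omega>. inner (step_incr \<tau> i) w + 1 / sqrt (real n) * (B (\<tau> (Suc i)) \<omega> - B (\<tau> i) \<omega>)) {..<k}"
    by simp
  moreover have "inner (step_incr \<tau> i) w + 1 / sqrt (real n) * (B (\<tau> (Suc i)) \<omega> - B (\<tau> i) \<omega>)
      = observation n w (\<tau> (Suc i)) \<omega> - observation n w (\<tau> i) \<omega>" for i \<omega>
    by (simp add: observation_def L2_primitive_eq_inner inner_diff_left right_diff_distrib step_incr_def diff_divide_distrib)
  ultimately show ?thesis by simp
qed

text \<open>Pointwise, the product density for \<open>w\<^sub>0\<close> is, up to the Bessel constant, the geometric mean of the
  densities for \<open>w\<close> and for the reflected signal \<open>2 w\<^sub>0 - w\<close>; the arithmetic mean with weights \<open>t\<close>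
  and \<open>1 / t\<close> makes the bound linear in the laws.\<close>

lemma increments_change_of_measure:
  assumes n: "0 < n" and \<tau>: "strict_mono_on {..k} \<tau>" "\<tau> ` {..k} \<subseteq> {0..1}" and k: "0 < k" and t: "0 < t"
    and F: "F \<in> borel_measurable (Pi\<^sub>M {..<k} (\<lambda>_. borel))" and F1: "\<And>x. F x \<le> 1"
  defines "Y \<equiv> \<lambda>w \<omega>. \<lambda>i\<in>{..<k}. observation n w (\<tau> (Suc i)) \<omega> - observation n w (\<tau> i) \<omega>"
  shows "2 * (\<integral>\<^sup>+\<omega>. F (Y w\<^sub>0 \<omega>) \<partial>N)
    \<le> ennreal (t * exp (real n * (norm (w\<^sub>0 - w))\<^sup>2)) * (\<integral>\<^sup>+\<omega>. F (Y w \<omega>) \<partial>N) + ennreal (1 / t)"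
proof -
  let ?L = "Pi\<^sub>M {..<k} (\<lambda>_. lborel :: real measure)"
  define \<Delta> where "\<Delta> i = \<tau> (Suc i) - \<tau> i" for i
  have m: "\<tau> i < \<tau> (Suc i)" if "i < k" for i
    using strict_mono_onD[OF \<tau>(1), of i "Suc i"] that by auto
  have \<Delta>: "0 < \<Delta> i" if "i < k" for i using m[OF that] by (simp add: \<Delta>_def)
  define \<sigma> where "\<sigma> i = sqrt (\<Delta> i / real n)" for i
  have \<sigma>: "0 < \<sigma> i" if "i < k" for i using \<Delta>[OF that] n by (simp add: \<sigma>_def)
  define \<phi> where "\<phi> w i x = normal_density (inner (step_incr \<tau> i) w) (\<sigma> i) x" for w i x
  have \<phi>0: "0 \<le> \<phi> w i x" for w i x by (simp add: \<phi>_def)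
  define K where "K = exp (real n * (norm (w\<^sub>0 - w))\<^sup>2)"
  have sets_eq: "sets ?L = sets (Pi\<^sub>M {..<k} (\<lambda>_. borel :: real measure))"
    by (intro sets_PiM_cong) auto
  have FL[measurable]: "F \<in> borel_measurable ?L"
    using F by (simp add: measurable_cong_sets[OF sets_eq refl])
  have \<phi>m[measurable]: "(\<lambda>x. ennreal (\<phi> w i x)) \<in> borel_measurable borel" for w i
    unfolding \<phi>_def by measurable
  have e: "(\<integral>\<^sup>+\<omega>. F (Y w \<omega>) \<partial>N) = (\<integral>\<^sup>+x. (\<Prod>i<k. ennreal (\<phi> w i (x i))) * F x \<partial>?L)" for w
    unfolding Y_def
  proof (rule nn_integral_indep_density[OF _ _ observation_increments_indep[OF \<tau>] _ F])
    show "distributed N lborel (\<lambda>\<omega>. observation n w (\<tau> (Suc i)) \<omega> - observation n w (\<tau> i) \<omega>) (\<lambda>x. ennreal (\<phi> w i x))"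
      if "i \<in> {..<k}" for i
    proof -
      have "\<tau> i \<in> {0..1}" "\<tau> (Suc i) \<in> {0..1}"
        using that by (auto intro!: subsetD[OF \<tau>(2)] simp del: atLeastAtMost_iff)
      then show ?thesis
        using observation_increment_distributed[OF n, of "\<tau> i" "\<tau> (Suc i)" w] m[of i] that
        by (simp add: \<phi>_def \<sigma>_def \<Delta>_def step_incr_def)
    qed
  qed (use k in auto)
  have pw: "2 * (\<Prod>i<k. ennreal (\<phi> w\<^sub>0 i (x i)))
     \<le> ennreal (t * K) * (\<Prod>i<k. ennreal (\<phi> w i (x i))) + ennreal (1 / t) * (\<Prod>i<k. ennreal (\<phi> (2 *\<^sub>R w\<^sub>0 - w) i (x i)))" for x
  proof -
    define P where "P = (\<Prod>i<k. \<phi> w\<^sub>0 i (x i))"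
    define Q where "Q = (\<Prod>i<k. \<phi> w i (x i))"
    define R where "R = (\<Prod>i<k. \<phi> (2 *\<^sub>R w\<^sub>0 - w) i (x i))"
    have nn: "0 \<le> P" "0 \<le> Q" "0 \<le> R" by (auto simp: P_def Q_def R_def intro!: prod_nonneg \<phi>0)
    have K0: "0 < K" by (simp add: K_def)
    have "P\<^sup>2 = (\<Prod>i<k. exp ((inner (step_incr \<tau> i) (w\<^sub>0 - w))\<^sup>2 / (\<sigma> i)\<^sup>2) * (\<phi> w i (x i) * \<phi> (2 *\<^sub>R w\<^sub>0 - w) i (x i)))"
      unfolding P_def prod_power_distrib
    proof (rule prod.cong)
      fix i assume "i \<in> {..<k}"
      then show "(\<phi> w\<^sub>0 i (x i))\<^sup>2 = exp ((inner (step_incr \<tau> i) (w\<^sub>0 - w))\<^sup>2 / (\<sigma> i)\<^sup>2) * (\<phi> w i (x i) * \<phi> (2 *\<^sub>R w\<^sub>0 - w) i (x i))"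
        unfolding \<phi>_def
        by (subst normal_density_square[where m'="inner (step_incr \<tau> i) w"])
          (simp_all add: \<sigma> inner_diff_right)
    qed simp
    also have "\<dots> = exp (\<Sum>i<k. (inner (step_incr \<tau> i) (w\<^sub>0 - w))\<^sup>2 / (\<sigma> i)\<^sup>2) * (Q * R)"
      by (simp add: prod.distrib exp_sum Q_def R_def)
    also have "(\<Sum>i<k. (inner (step_incr \<tau> i) (w\<^sub>0 - w))\<^sup>2 / (\<sigma> i)\<^sup>2)
        = real n * (\<Sum>i<k. (inner (step_incr \<tau> i) (w\<^sub>0 - w))\<^sup>2 / \<Delta> i)"
      unfolding sum_distrib_left
    proof (rule sum.cong)
      fix i assume "i \<in> {..<k}"
      then have "(\<sigma> i)\<^sup>2 = \<Delta> i / real n" using \<Delta>[of i] n by (simp add: \<sigma>_def)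
      then show "(inner (step_incr \<tau> i) (w\<^sub>0 - w))\<^sup>2 / (\<sigma> i)\<^sup>2 = real n * ((inner (step_incr \<tau> i) (w\<^sub>0 - w))\<^sup>2 / \<Delta> i)"
        by simp
    qed simp
    \<comment> \<open>Bessel's inequality makes the constant independent of the grid. This
      uniformity lets the bound reach all events of the path space.\<close>
    also have "exp (real n * (\<Sum>i<k. (inner (step_incr \<tau> i) (w\<^sub>0 - w))\<^sup>2 / \<Delta> i)) * (Q * R) \<le> K * (Q * R)"
      unfolding K_def using nn
      by (intro mult_right_mono iffD2[OF exp_le_cancel_iff] mult_left_mono bessel_inequality)
        (auto simp: inner_step_incr[OF \<tau>] \<Delta>_def m)
    finally have "P\<^sup>2 \<le> K * (Q * R)" .
    \<comment> \<open>This split prepares the inequality 4ab <= (a + b)^2 with the weight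
      \<open>t\<close> on the law of \<open>w\<close>.\<close>
    also have "\<dots> = (t * K * Q) * (1 / t * R)" using t by simp
    finally have "4 * P\<^sup>2 \<le> (t * K * Q + 1 / t * R)\<^sup>2"
      using zero_le_power2[of "t * K * Q - 1 / t * R"] unfolding power2_diff power2_sum by linarith
    then have "(2 * P)\<^sup>2 \<le> (t * K * Q + 1 / t * R)\<^sup>2" by (simp add: power_mult_distrib)
    then have "2 * P \<le> t * K * Q + 1 / t * R"
      by (rule power2_le_imp_le) (use nn t K0 in simp)
    then have "ennreal (2 * P) \<le> ennreal (t * K * Q + 1 / t * R)" by (rule ennreal_leI)
    also have "ennreal (t * K * Q + 1 / t * R) = ennreal (t * K) * ennreal Q + ennreal (1 / t) * ennreal R"
      using nn t K0 by (simp add: ennreal_mult[symmetric] ennreal_plus[symmetric] del: ennreal_plus)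
    finally show ?thesis
      using nn by (simp add: P_def Q_def R_def prod_ennreal \<phi>0 ennreal_mult)
  qed
  \<comment> \<open>The reflected signal is auxiliary: its expectation is bounded trivially through
    \<open>F \<le> 1\<close>, and what remains of it is the summand 1/t.\<close>
  have R1: "(\<integral>\<^sup>+\<omega>. F (Y (2 *\<^sub>R w\<^sub>0 - w) \<omega>) \<partial>N) \<le> 1"
  proof -
    have "(\<integral>\<^sup>+\<omega>. F (Y (2 *\<^sub>R w\<^sub>0 - w) \<omega>) \<partial>N) \<le> (\<integral>\<^sup>+\<omega>. 1 \<partial>N)"
      by (intro nn_integral_mono F1)
    also have "\<dots> = 1" by (simp add: emeasure_space_1)
    finally show ?thesis .
  qed
  have "2 * (\<integral>\<^sup>+\<omega>. F (Y w\<^sub>0 \<omega>) \<partial>N) = (\<integral>\<^sup>+x. 2 * (\<Prod>i<k. ennreal (\<phi> w\<^sub>0 i (x i))) * F x \<partial>?L)"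
    unfolding e by (simp add: nn_integral_cmult mult.assoc)
  also have "\<dots> \<le> (\<integral>\<^sup>+x. (ennreal (t * K) * (\<Prod>i<k. ennreal (\<phi> w i (x i))) + ennreal (1 / t) * (\<Prod>i<k. ennreal (\<phi> (2 *\<^sub>R w\<^sub>0 - w) i (x i)))) * F x \<partial>?L)"
    by (intro nn_integral_mono mult_right_mono pw) auto
  also have "\<dots> = ennreal (t * K) * (\<integral>\<^sup>+\<omega>. F (Y w \<omega>) \<partial>N) + ennreal (1 / t) * (\<integral>\<^sup>+\<omega>. F (Y (2 *\<^sub>R w\<^sub>0 - w) \<omega>) \<partial>N)"
    unfolding e by (simp add: distrib_right nn_integral_add nn_integral_cmult mult.assoc)
  also have "\<dots> \<le> ennreal (t * K) * (\<integral>\<^sup>+\<omega>. F (Y w \<omega>) \<partial>N) + ennreal (1 / t) * 1"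
    by (intro add_left_mono mult_left_mono R1) auto
  finally show ?thesis by (simp add: K_def)
qed

end

section \<open>From finitely many increments to all events of the path space\<close>

context brownian
begin

text \<open>The path law on the full product space, whose sigma-algebra is generated by the cylinder
  sets; \<open>C01\<close> carries only the trace of it.\<close>

definition product_law :: "nat \<Rightarrow> L2 \<Rightarrow> (real \<Rightarrow> real) measure" where
  "product_law n w = distr N (Pi\<^sub>M {0..1} (\<lambda>_. borel)) (\<lambda>\<omega>. \<lambda>t\<in>{0..1}. observation n w t \<omega>)"

lemma prob_space_product_law: "prob_space (product_law n w)"
  unfolding product_law_def by (rule prob_space_distr[OF path_measurable_PiM])

text \<open>The set of continuous functions is not measurable in the product space, so it cannot be
  treated there as an event of probability one. Every path is continuous, however, and hence the
  preimages of \<open>E\<close> and \<open>A\<close> coincide.\<close>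

lemma measure_white_noise_law:
  assumes A: "A \<in> sets (Pi\<^sub>M {0..1} (\<lambda>_. borel))"
    and E: "E = {x. continuous_on {0..1} x} \<inter> A"
  shows "measure (white_noise_law N B n w) E = measure (product_law n w) A"
proof -
  have Es: "E \<in> sets C01" unfolding C01_def E using A by (auto simp: sets_restrict_space)
  let ?X = "\<lambda>\<omega>. \<lambda>t\<in>{0..1}. observation n w t \<omega>"
  have "?X \<omega> \<in> {x. continuous_on {0..1} x}" if "\<omega> \<in> space N" for \<omega>
    using measurable_space[OF path_measurable that, of n w] by (simp add: C01_def space_restrict_space)
  then have "?X -` E \<inter> space N = ?X -` A \<inter> space N" unfolding E by blast
  then show ?thesis
    unfolding white_noise_law_eq product_law_def
    by (simp add: measure_distr[OF path_measurable Es] measure_distr[OF path_measurable_PiM A])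
qed

lemma cylinder_change_of_measure:
  assumes n: "0 < n" and t: "0 < t" and A: "A \<in> cylinder_sets {0..1}"
  shows "2 * measure (product_law n w\<^sub>0) A
    \<le> t * exp (real n * (norm (w\<^sub>0 - w))\<^sup>2) * measure (product_law n w) A + 1 / t"
proof -
  obtain J S where J: "finite J" "J \<subseteq> {0..1}" and S: "S \<in> sets (Pi\<^sub>M J (\<lambda>_. borel))"
    and Aeq: "A = prod_emb {0..1} (\<lambda>_. borel) J S" using A by (rule cylinder_setsE)
  \<comment> \<open>Adding 0 lets path values be recovered as sums of increments; adding 1
    guarantees two distinct points and hence at least one increment.\<close>
  define J' where "J' = insert 0 (insert 1 J)"
  have J': "finite J'" "J' \<subseteq> {0..1}" using J by (auto simp: J'_def)
  define k where "k = card J' - 1"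
  have "card {0, 1::real} \<le> card J'" using J'(1) by (intro card_mono) (auto simp: J'_def)
  then have card: "card J' = Suc k" and k: "0 < k" by (auto simp: k_def)
  define \<tau> where "\<tau> i = sorted_list_of_set J' ! i" for i
  have len: "length (sorted_list_of_set J') = Suc k" using card by simp
  have mono: "strict_mono_on {..k} \<tau>"
    unfolding \<tau>_def using len
    by (intro strict_mono_onI sorted_wrt_nth_less[OF strict_sorted_list_of_set]) auto
  have mem: "\<tau> i \<in> J'" if "i \<le> k" for i
    using nth_mem[of i "sorted_list_of_set J'"] that len J'(1) by (simp add: \<tau>_def)
  have range: "\<tau> ` {..k} \<subseteq> {0..1}" using mem J'(2) by auto
  have surj: "\<exists>i\<le>k. \<tau> i = s" if "s \<in> J'" for s
  proof -
    have "s \<in> set (sorted_list_of_set J')" using that J'(1) by simp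
    then show ?thesis unfolding in_set_conv_nth \<tau>_def using len by (auto simp: less_Suc_eq_le)
  qed
  have \<tau>0: "\<tau> 0 = 0"
  proof -
    obtain i where i: "i \<le> k" "\<tau> i = 0" using surj[of 0] by (auto simp: J'_def)
    have "0 \<le> \<tau> 0" using mem[of 0] J'(2) by auto
    then show ?thesis using i strict_mono_onD[OF mono, of 0 i] by (cases "i = 0") auto
  qed
  have "\<forall>s\<in>J. \<exists>i\<le>k. \<tau> i = s" using surj by (auto simp: J'_def)
  then obtain ix where ix: "\<And>s. s \<in> J \<Longrightarrow> ix s \<le> k" "\<And>s. s \<in> J \<Longrightarrow> \<tau> (ix s) = s" by metis
  \<comment> \<open>Rebuilds the values at the times in \<open>J\<close> from the increments. The
    sums telescope exactly because \<open>\<tau>\<close> starts at 0, where the path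
    vanishes.\<close>
  define G where "G y = (\<lambda>s\<in>J. \<Sum>i<ix s. y i)" for y :: "nat \<Rightarrow> real"
  have Gm: "G \<in> measurable (Pi\<^sub>M {..<k} (\<lambda>_. borel)) (Pi\<^sub>M J (\<lambda>_. borel))"
    unfolding G_def
  proof (intro measurable_restrict borel_measurable_sum)
    fix s i assume "s \<in> J" "i \<in> {..<ix s}"
    then show "(\<lambda>y. y i) \<in> borel_measurable (Pi\<^sub>M {..<k} (\<lambda>_. borel))"
      using ix(1)[of s] by (intro measurable_component_singleton) auto
  qed
  define F where "F y = (indicator S (G y) :: ennreal)" for y :: "nat \<Rightarrow> real"
  have Fm: "F \<in> borel_measurable (Pi\<^sub>M {..<k} (\<lambda>_. borel))"
    unfolding F_def by (intro measurable_compose[OF Gm] borel_measurable_indicator S)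
  define Y where "Y w \<omega> = (\<lambda>i\<in>{..<k}. observation n w (\<tau> (Suc i)) \<omega> - observation n w (\<tau> i) \<omega>)" for w \<omega>
  have GY: "G (Y w \<omega>) = (\<lambda>s\<in>J. observation n w s \<omega>)" if \<omega>: "\<omega> \<in> space N" for w \<omega>
  proof -
    have "(\<Sum>i<ix s. Y w \<omega> i) = observation n w s \<omega>" if s: "s \<in> J" for s
    proof -
      have "(\<Sum>i<ix s. Y w \<omega> i) = (\<Sum>i<ix s. observation n w (\<tau> (Suc i)) \<omega> - observation n w (\<tau> i) \<omega>)"
        using ix(1)[OF s] by (intro sum.cong) (auto simp: Y_def)
      also have "\<dots> = observation n w (\<tau> (ix s)) \<omega> - observation n w (\<tau> 0) \<omega>"
        by (rule sum_lessThan_telescope)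
      also have "\<dots> = observation n w s \<omega>"
        using ix(2)[OF s] \<omega> by (simp add: \<tau>0 observation_0)
      finally show ?thesis .
    qed
    then show ?thesis by (auto simp: G_def)
  qed
  have As: "A \<in> sets (Pi\<^sub>M {0..1} (\<lambda>_. borel))"
    unfolding Aeq using J S by (intro measurable_prod_emb) auto
  have e: "(\<integral>\<^sup>+\<omega>. F (Y w \<omega>) \<partial>N) = emeasure (product_law n w) A" for w
  proof -
    have "(\<integral>\<^sup>+\<omega>. F (Y w \<omega>) \<partial>N) = (\<integral>\<^sup>+\<omega>. indicator A (\<lambda>t\<in>{0..1}. observation n w t \<omega>) \<partial>N)"
    proof (rule nn_integral_cong)
      fix \<omega> assume "\<omega> \<in> space N"
      then show "F (Y w \<omega>) = indicator A (\<lambda>t\<in>{0..1}. observation n w t \<omega>)"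
        unfolding F_def GY[OF \<open>\<omega> \<in> space N\<close>] Aeq using J(2)
        by (auto simp: indicator_def prod_emb_def restrict_restrict Int_absorb1)
    qed
    also have "\<dots> = (\<integral>\<^sup>+x. indicator A x \<partial>product_law n w)"
      unfolding product_law_def
      by (rule nn_integral_distr[OF path_measurable_PiM, symmetric]) (use As in simp)
    also have "\<dots> = emeasure (product_law n w) A"
      using As by (intro nn_integral_indicator) (simp add: product_law_def)
    finally show ?thesis .
  qed
  have "2 * emeasure (product_law n w\<^sub>0) A
      \<le> ennreal (t * exp (real n * (norm (w\<^sub>0 - w))\<^sup>2)) * emeasure (product_law n w) A + ennreal (1 / t)"
    unfolding e[symmetric] Y_def
    by (rule increments_change_of_measure[OF n mono range k t Fm]) (simp add: F_def indicator_def)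
  moreover have fin: "finite_measure (product_law n w)" for w
    using prob_space_product_law by (simp add: prob_space_def)
  ultimately have "ennreal (2 * measure (product_law n w\<^sub>0) A)
      \<le> ennreal (t * exp (real n * (norm (w\<^sub>0 - w))\<^sup>2) * measure (product_law n w) A + 1 / t)"
    using t by (simp add: finite_measure.emeasure_eq_measure[OF fin] ennreal_mult ennreal_plus)
  then show ?thesis using t by (subst (asm) ennreal_le_iff) auto
qed

text \<open>For a fixed event the affine bound holds for every \<open>t > 0\<close>, and its
  minimum, attained at t = 1 / sqrt(K Q), restores the quadratic inequality.\<close>

lemma white_noise_change_of_measure:
  assumes n: "0 < n" and E: "E \<in> sets C01"
  shows "(measure (white_noise_law N B n w\<^sub>0) E)\<^sup>2
    \<le> exp (real n * (norm (w\<^sub>0 - w))\<^sup>2) * measure (white_noise_law N B n w) E"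
proof -
  define K where "K = exp (real n * (norm (w\<^sub>0 - w))\<^sup>2)"
  have K: "0 < K" by (simp add: K_def)
  obtain A where A: "A \<in> sets (Pi\<^sub>M {0..1} (\<lambda>_. borel))" and Eeq: "E = {x. continuous_on {0..1} x} \<inter> A"
    using E by (auto simp: C01_def sets_restrict_space)
  define P where "P = measure (product_law n w\<^sub>0) A"
  define Q where "Q = measure (product_law n w) A"
  have lin: "2 * P \<le> t * K * Q + 1 / t" if t: "0 < t" for t
  proof -
    have fin: "finite_measure (product_law n w)" for w
      using prob_space_product_law by (simp add: prob_space_def)
    have "P \<le> (t * K / 2) * Q + 1 / (2 * t)"
      unfolding P_def Q_def
    proof (rule linear_bound_extends_from_algebra[OF algebra_cylinder_sets fin _ fin])
      show "A \<in> sigma_sets (space (Pi\<^sub>M {0..1} (\<lambda>_. borel))) (cylinder_sets {0..1})"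
        using A by (simp add: sets_PiM_eq_cylinder_sets)
      show "measure (product_law n w\<^sub>0) A \<le> t * K / 2 * measure (product_law n w) A + 1 / (2 * t)"
        if "A \<in> cylinder_sets {0..1}" for A
        using cylinder_change_of_measure[OF n t that, of w\<^sub>0 w] by (simp add: K_def)
    qed (use t K in \<open>auto simp: product_law_def sets_PiM_eq_cylinder_sets\<close>)
    then show ?thesis by simp
  qed
  have "P\<^sup>2 \<le> K * Q"
  proof (cases "Q = 0")
    case True
    \<comment> \<open>There is no minimiser when Q = 0; the choice t = 1/P reduces the bound to 2P
      <= P.\<close>
    have "P \<le> 0"
    proof (rule ccontr)
      assume "\<not> P \<le> 0"
      with lin[of "1 / P"] True show False by simp
    qed
    moreover have "0 \<le> P" by (simp add: P_def)
    ultimately show ?thesis using True by simp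
  next
    case False
    then have Q: "0 < K * Q" using K by (simp add: Q_def zero_less_measure_iff)
    define r where "r = sqrt (K * Q)"
    have r: "0 < r" "K * Q = r\<^sup>2" using Q by (auto simp: r_def)
    have "2 * P \<le> 1 / r * (K * Q) + r" using lin[of "1 / r"] r(1) by simp
    also have "\<dots> = 2 * r" using r by (simp add: power2_eq_square)
    finally have "P\<^sup>2 \<le> r\<^sup>2" by (intro power_mono) (auto simp: P_def)
    then show ?thesis by (simp add: r)
  qed
  then show ?thesis
    unfolding measure_white_noise_law[OF A Eeq] by (simp add: K_def P_def Q_def)
qed

end

section \<open>Tests built from increments along a grid\<close>

lemma normal_density_mgf:
  assumes "0 < \<sigma>"
  shows "normal_density m \<sigma> x * exp (c * x)
    = exp (c * m + c\<^sup>2 * \<sigma>\<^sup>2 / 2) * normal_density (m + c * \<sigma>\<^sup>2) \<sigma> x"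
proof -
  have "- (x - m)\<^sup>2 / (2 * \<sigma>\<^sup>2) + c * x = (c * m + c\<^sup>2 * \<sigma>\<^sup>2 / 2) + (- (x - (m + c * \<sigma>\<^sup>2))\<^sup>2 / (2 * \<sigma>\<^sup>2))"
    using assms by (simp add: field_simps power2_eq_square)
  then have "exp (- (x - m)\<^sup>2 / (2 * \<sigma>\<^sup>2)) * exp (c * x)
      = exp (c * m + c\<^sup>2 * \<sigma>\<^sup>2 / 2) * exp (- (x - (m + c * \<sigma>\<^sup>2))\<^sup>2 / (2 * \<sigma>\<^sup>2))"
    by (simp only: exp_add[symmetric])
  then show ?thesis by (simp add: normal_density_def)
qed

lemma (in prob_space) normal_mgf:
  assumes X: "distributed M lborel X (\<lambda>x. ennreal (normal_density m \<sigma> x))" and \<sigma>: "0 < \<sigma>"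
  shows "(\<integral>\<^sup>+\<omega>. ennreal (exp (c * X \<omega>)) \<partial>M) = ennreal (exp (c * m + c\<^sup>2 * \<sigma>\<^sup>2 / 2))"
proof -
  have "(\<integral>\<^sup>+\<omega>. ennreal (exp (c * X \<omega>)) \<partial>M)
      = (\<integral>\<^sup>+x. ennreal (normal_density m \<sigma> x) * ennreal (exp (c * x)) \<partial>lborel)"
    by (rule distributed_nn_integral[OF X, symmetric]) simp
  also have "\<dots> = (\<integral>\<^sup>+x. ennreal (exp (c * m + c\<^sup>2 * \<sigma>\<^sup>2 / 2)) * ennreal (normal_density (m + c * \<sigma>\<^sup>2) \<sigma> x) \<partial>lborel)"
    by (simp add: ennreal_mult'[symmetric] normal_density_mgf[OF \<sigma>])
  also have "\<dots> = ennreal (exp (c * m + c\<^sup>2 * \<sigma>\<^sup>2 / 2)) * (\<integral>\<^sup>+x. ennreal (normal_density (m + c * \<sigma>\<^sup>2) \<sigma> x) \<partial>lborel)"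
    by (rule nn_integral_cmult) simp
  also have "(\<integral>\<^sup>+x. ennreal (normal_density (m + c * \<sigma>\<^sup>2) \<sigma> x) \<partial>lborel) = 1"
    using prob_space.emeasure_space_1[OF prob_space_normal_density[OF \<sigma>, of "m + c * \<sigma>\<^sup>2"]]
    by (simp add: emeasure_density)
  finally show ?thesis by simp
qed

text \<open>The Wiener integral of \<open>grid_step k a\<close> against the path. For a step
  function it is a finite sum, defined path by path; under the signal \<open>w\<close> it is
  Gaussian with mean \<open>inner (grid_step k a) w\<close> and variance |grid_step k a|^2 /
  n.\<close>

definition grid_statistic :: "nat \<Rightarrow> (nat \<Rightarrow> real) \<Rightarrow> (real \<Rightarrow> real) \<Rightarrow> real" where
  "grid_statistic k a x = (\<Sum>i<k. a i * (x (real (Suc i) / real k) - x (real i / real k)))"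

lemma grid_statistic_measurable[measurable]: "grid_statistic k a \<in> borel_measurable C01"
  unfolding grid_statistic_def C01_def
proof (intro measurable_restrict_space1 borel_measurable_sum borel_measurable_times borel_measurable_diff borel_measurable_const)
  fix i assume "i \<in> {..<k}"
  then show "(\<lambda>x. x (real (Suc i) / real k)) \<in> borel_measurable (Pi\<^sub>M {0..1} (\<lambda>_. borel))"
    "(\<lambda>x. x (real i / real k)) \<in> borel_measurable (Pi\<^sub>M {0..1} (\<lambda>_. borel))"
    by (auto intro!: measurable_component_singleton simp: divide_le_eq_1)
qed

context brownian
begin

lemma grid_statistic_mgf:
  assumes n: "0 < n" and k: "0 < k"
  shows "(\<integral>\<^sup>+x. ennreal (exp (c * grid_statistic k a x)) \<partial>white_noise_law N B n w)
    = ennreal (exp (c * inner (grid_step k a) w + c\<^sup>2 * (norm (grid_step k a))\<^sup>2 / (2 * real n)))"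
proof -
  define \<tau> where "\<tau> i = real i / real k" for i
  have \<tau>: "strict_mono_on {..k} \<tau>" "\<tau> ` {..k} \<subseteq> {0..1}"
    using k by (auto simp: \<tau>_def strict_mono_on_def divide_strict_right_mono divide_le_eq_1)
  have \<tau>m: "\<tau> i < \<tau> (Suc i)" "0 \<le> \<tau> i" for i using k by (auto simp: \<tau>_def divide_strict_right_mono)
  have \<tau>1: "\<tau> (Suc i) \<le> 1" if "i < k" for i using that by (simp add: \<tau>_def divide_le_eq_1)
  define X where "X i \<omega> = observation n w (\<tau> (Suc i)) \<omega> - observation n w (\<tau> i) \<omega>" for i \<omega>
  have gs: "grid_step k a = (\<Sum>i<k. a i *\<^sub>R step_incr \<tau> i)"
    by (simp add: grid_step_def step_incr_def \<tau>_def)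
  have Xind: "indep_vars (\<lambda>_. borel) X {..<k}"
    using observation_increments_indep[OF \<tau>, of n w] by (simp add: X_def[abs_def])
  have Xd: "distributed N lborel (X i) (\<lambda>x. ennreal (normal_density (inner (step_incr \<tau> i) w) (sqrt ((\<tau> (Suc i) - \<tau> i) / real n)) x))"
    if "i < k" for i
    using observation_increment_distributed[OF n \<tau>m(2)[of i] \<tau>m(1)[of i] \<tau>1[OF that], of w]
    by (simp add: X_def[abs_def] step_incr_def)
  have "(norm (grid_step k a))\<^sup>2 = (\<Sum>i<k. \<Sum>j<k. a i * (a j * inner (step_incr \<tau> i) (step_incr \<tau> j)))"
    unfolding gs power2_norm_eq_inner by (simp add: inner_sum_left inner_sum_right sum_distrib_left inner_commute mult.left_commute)
  also have "\<dots> = (\<Sum>i<k. \<Sum>j<k. if i = j then (a i)\<^sup>2 * (\<tau> (Suc i) - \<tau> i) else 0)"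
    by (intro sum.cong refl) (simp add: inner_step_incr[OF \<tau>] power2_eq_square)
  finally have ng: "(norm (grid_step k a))\<^sup>2 = (\<Sum>i<k. (a i)\<^sup>2 * (\<tau> (Suc i) - \<tau> i))" by simp
  have "(\<integral>\<^sup>+x. ennreal (exp (c * grid_statistic k a x)) \<partial>white_noise_law N B n w)
      = (\<integral>\<^sup>+\<omega>. ennreal (exp (c * grid_statistic k a (\<lambda>t\<in>{0..1}. observation n w t \<omega>))) \<partial>N)"
    unfolding white_noise_law_eq by (rule nn_integral_distr[OF path_measurable]) measurable
  also have "\<dots> = (\<integral>\<^sup>+\<omega>. (\<Prod>i<k. ennreal (exp (c * a i * X i \<omega>))) \<partial>N)"
  proof (rule nn_integral_cong)
    fix \<omega>
    have "grid_statistic k a (\<lambda>t\<in>{0..1}. observation n w t \<omega>) = (\<Sum>i<k. a i * X i \<omega>)"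
      unfolding grid_statistic_def
    proof (rule sum.cong)
      fix i assume i: "i \<in> {..<k}"
      then have "\<tau> i \<in> {0..1}" "\<tau> (Suc i) \<in> {0..1}"
        using \<tau>m[of i] \<tau>m(2)[of "Suc i"] \<tau>1[of i] by auto
      then show "a i * ((\<lambda>t\<in>{0..1}. observation n w t \<omega>) (real (Suc i) / real k) -
          (\<lambda>t\<in>{0..1}. observation n w t \<omega>) (real i / real k)) = a i * X i \<omega>"
        by (simp add: X_def \<tau>_def del: of_nat_Suc)
    qed simp
    then show "ennreal (exp (c * grid_statistic k a (\<lambda>t\<in>{0..1}. observation n w t \<omega>)))
        = (\<Prod>i<k. ennreal (exp (c * a i * X i \<omega>)))"
      by (simp add: prod_ennreal exp_sum[symmetric] sum_distrib_left mult.assoc)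
  qed
  also have "\<dots> = (\<Prod>i<k. \<integral>\<^sup>+\<omega>. ennreal (exp (c * a i * X i \<omega>)) \<partial>N)"
    by (rule indep_vars_nn_integral)
      (use indep_vars_compose2[OF Xind, of "\<lambda>i x. ennreal (exp (c * a i * x))" "\<lambda>_. borel"] in auto)
  also have "\<dots> = (\<Prod>i<k. ennreal (exp (c * a i * inner (step_incr \<tau> i) w + (c * a i)\<^sup>2 * ((\<tau> (Suc i) - \<tau> i) / real n) / 2)))"
  proof (rule prod.cong)
    fix i assume i: "i \<in> {..<k}"
    show "(\<integral>\<^sup>+\<omega>. ennreal (exp (c * a i * X i \<omega>)) \<partial>N)
        = ennreal (exp (c * a i * inner (step_incr \<tau> i) w + (c * a i)\<^sup>2 * ((\<tau> (Suc i) - \<tau> i) / real n) / 2))"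
      using normal_mgf[OF Xd, of i "c * a i"] i \<tau>m[of i] n by simp
  qed simp
  also have "\<dots> = ennreal (exp (\<Sum>i<k. c * a i * inner (step_incr \<tau> i) w + (c * a i)\<^sup>2 * ((\<tau> (Suc i) - \<tau> i) / real n) / 2))"
    by (simp add: prod_ennreal exp_sum)
  also have "(\<Sum>i<k. c * a i * inner (step_incr \<tau> i) w + (c * a i)\<^sup>2 * ((\<tau> (Suc i) - \<tau> i) / real n) / 2)
      = c * inner (grid_step k a) w + c\<^sup>2 * (norm (grid_step k a))\<^sup>2 / (2 * real n)"
    unfolding ng unfolding gs
    by (simp add: sum.distrib inner_sum_left sum_distrib_left sum_divide_distrib power_mult_distrib mult_ac)
  finally show ?thesis .
qed

text \<open>The exponential Markov inequality. The factor \<open>c\<close> stays inside the event,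
  so its sign selects the upper or the lower tail.\<close>

lemma grid_statistic_tail:
  assumes n: "0 < n" and k: "0 < k"
  shows "measure (white_noise_law N B n w) {x \<in> space C01. c * inner (grid_step k a) w + s \<le> c * grid_statistic k a x}
    \<le> exp (c\<^sup>2 * (norm (grid_step k a))\<^sup>2 / (2 * real n) - s)"
proof -
  let ?P = "white_noise_law N B n w"
  let ?A = "{x \<in> space C01. c * inner (grid_step k a) w + s \<le> c * grid_statistic k a x}"
  let ?r = "- (c * inner (grid_step k a) w + s)"
  interpret P: prob_space ?P by (rule prob_space_white_noise_law)
  have "?A \<in> sets ?P" by measurable
  then have "emeasure ?P ?A = (\<integral>\<^sup>+x. indicator ?A x \<partial>?P)" by simp
  also have "\<dots> \<le> (\<integral>\<^sup>+x. ennreal (exp ?r) * ennreal (exp (c * grid_statistic k a x)) \<partial>?P)"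
    by (intro nn_integral_mono) (auto simp: indicator_def ennreal_mult[symmetric] exp_add[symmetric])
  also have "\<dots> = ennreal (exp ?r) * (\<integral>\<^sup>+x. ennreal (exp (c * grid_statistic k a x)) \<partial>?P)"
    by (rule nn_integral_cmult) measurable
  also have "\<dots> = ennreal (exp (c\<^sup>2 * (norm (grid_step k a))\<^sup>2 / (2 * real n) - s))"
    unfolding grid_statistic_mgf[OF n k] by (simp add: ennreal_mult[symmetric] exp_add[symmetric])
  finally show ?thesis by (simp add: P.emeasure_eq_measure)
qed

text \<open>The likelihood ratio test of \<open>w\<^sub>0\<close> against \<open>w\<^sub>1\<close>
  thresholds the Wiener integral of \<open>w\<^sub>1 - w\<^sub>0\<close>. A grid step within D/8 of
  this difference is used instead, and the test still works for all signals within D/8 of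
  \<open>w\<^sub>1\<close>.\<close>

lemma white_noise_test:
  assumes n: "0 < n" and D: "D = norm (w\<^sub>1 - w\<^sub>0)" "0 < D"
  shows "\<exists>T\<in>sets C01. measure (white_noise_law N B n w\<^sub>0) T \<le> exp (- (real n * D\<^sup>2 / 64)) \<and>
    (\<forall>w. norm (w - w\<^sub>1) \<le> D / 8 \<longrightarrow>
      measure (white_noise_law N B n w) (space C01 - T) \<le> exp (- (real n * D\<^sup>2 / 64)))"
proof -
  define d where "d = w\<^sub>1 - w\<^sub>0"
  have dD: "norm d = D" using D by (simp add: d_def)
  obtain k a where k: "0 < k" and "dist (grid_step k a) d < D / 8"
    using grid_steps_dense[of d] D(2) unfolding closure_approachable by (auto dest!: spec[of _ "D / 8"])
  define g where "g = grid_step k a"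
  have gd: "norm (g - d) \<le> D / 8" using \<open>dist (grid_step k a) d < D / 8\<close> by (simp add: g_def dist_norm)
  have "norm g \<le> norm d + norm (g - d)" by (metis add.commute diff_add_cancel norm_triangle_ineq)
  then have "norm g \<le> 9 * D / 8" using gd dD by simp
  then have gn: "(norm g)\<^sup>2 \<le> 81 * D\<^sup>2 / 64"
    using power_mono[of "norm g" "9 * D / 8" 2] by (simp add: power_divide power_mult_distrib)
  \<comment> \<open>The mean of the statistic grows by about D^2 from \<open>w\<^sub>0\<close> to
    \<open>w\<^sub>1\<close>; the threshold lies halfway.\<close>
  define T where "T = {x \<in> space C01. inner g w\<^sub>0 + D\<^sup>2 / 2 \<le> grid_statistic k a x}"
  have T: "T \<in> sets C01" unfolding T_def by measurable
  have sets: "sets (white_noise_law N B n w) = sets C01" for w by simp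
  have n0: "0 < real n" using n by simp
  have nD: "0 \<le> real n * D\<^sup>2" by simp
  \<comment> \<open>The tail bound is used with c = n/2. In units of n D^2 its exponent is at most
    81/512 - 1/4 = -47/512, below -1/64.\<close>
  have "T \<subseteq> {x \<in> space C01. (real n / 2) * inner (grid_step k a) w\<^sub>0 + real n * D\<^sup>2 / 4 \<le> (real n / 2) * grid_statistic k a x}"
  proof
    fix x assume "x \<in> T"
    then have "x \<in> space C01" and "inner g w\<^sub>0 + D\<^sup>2 / 2 \<le> grid_statistic k a x" by (auto simp: T_def)
    then have "(real n / 2) * (inner g w\<^sub>0 + D\<^sup>2 / 2) \<le> (real n / 2) * grid_statistic k a x"
      by (intro mult_left_mono) auto
    with \<open>x \<in> space C01\<close> show "x \<in> {x \<in> space C01. (real n / 2) * inner (grid_step k a) w\<^sub>0 + real n * D\<^sup>2 / 4 \<le> (real n / 2) * grid_statistic k a x}"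
      by (simp add: g_def algebra_simps)
  qed
  then have "measure (white_noise_law N B n w\<^sub>0) T
      \<le> measure (white_noise_law N B n w\<^sub>0) {x \<in> space C01. (real n / 2) * inner (grid_step k a) w\<^sub>0 + real n * D\<^sup>2 / 4 \<le> (real n / 2) * grid_statistic k a x}"
    by (intro finite_measure.finite_measure_mono prob_space.finite_measure prob_space_white_noise_law)
      (simp_all, measurable)
  also have "\<dots> \<le> exp ((real n / 2)\<^sup>2 * (norm (grid_step k a))\<^sup>2 / (2 * real n) - real n * D\<^sup>2 / 4)"
    by (rule grid_statistic_tail[OF n k])
  also have "\<dots> \<le> exp (- (real n * D\<^sup>2 / 64))"
  proof -
    have "(real n / 2)\<^sup>2 * (norm g)\<^sup>2 / (2 * real n) = real n * (norm g)\<^sup>2 / 8"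
      using n0 by (simp add: power2_eq_square field_simps)
    also have "\<dots> \<le> real n * (81 * D\<^sup>2 / 64) / 8"
      using gn n0 by (intro divide_right_mono mult_left_mono) auto
    finally show ?thesis
      using nD unfolding g_def exp_le_cancel_iff by linarith
  qed
  finally have 1: "measure (white_noise_law N B n w\<^sub>0) T \<le> exp (- (real n * D\<^sup>2 / 64))" .
  have 2: "measure (white_noise_law N B n w) (space C01 - T) \<le> exp (- (real n * D\<^sup>2 / 64))"
    if w: "norm (w - w\<^sub>1) \<le> D / 8" for w
  proof -
    have i1: "\<bar>inner g (w - w\<^sub>1)\<bar> \<le> (9 * D / 8) * (D / 8)"
      using Cauchy_Schwarz_ineq2[of g "w - w\<^sub>1"] mult_mono[OF \<open>norm g \<le> 9 * D / 8\<close> w] D(2) by simp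
    have i2: "\<bar>inner (g - d) d\<bar> \<le> (D / 8) * D"
      using order.trans[OF Cauchy_Schwarz_ineq2[of "g - d" d, unfolded dD] mult_right_mono[OF gd]] D(2)
      by simp
    have i1': "\<bar>inner g (w - w\<^sub>1)\<bar> \<le> 9 / 64 * D\<^sup>2" and i2': "\<bar>inner (g - d) d\<bar> \<le> 1 / 8 * D\<^sup>2"
      using i1 i2 by (simp_all add: power2_eq_square)
    \<comment> \<open>The ideal gain D^2 loses 1/8 of itself by replacing d with g and 9/64 by
      moving from \<open>w\<^sub>1\<close> to w, which leaves 47/64.\<close>
    have "inner g (w - w\<^sub>0) = inner d d + inner (g - d) d + inner g (w - w\<^sub>1)"
      by (simp add: d_def inner_diff_left inner_diff_right)
    moreover have "inner d d = D\<^sup>2" using dD by (simp add: power2_norm_eq_inner[symmetric])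
    ultimately have gw: "47 / 64 * D\<^sup>2 \<le> inner g w - inner g w\<^sub>0"
      using i1' i2' unfolding inner_diff_right by linarith
    \<comment> \<open>Below the threshold the statistic falls short of its mean by (47/64 - 1/2) D^2
      = 15/64 D^2. The lower tail with c = -n/4 has, in units of n D^2, exponent at most 81/2048 -
      15/256 = -39/2048, again below -1/64.\<close>
    have "space C01 - T \<subseteq> {x \<in> space C01. (- (real n / 4)) * inner (grid_step k a) w + real n * (15 / 256 * D\<^sup>2) \<le> (- (real n / 4)) * grid_statistic k a x}"
    proof
      fix x assume "x \<in> space C01 - T"
      then have x: "x \<in> space C01" and "grid_statistic k a x \<le> inner g w\<^sub>0 + D\<^sup>2 / 2" by (auto simp: T_def)
      then have "grid_statistic k a x \<le> inner g w - 15 / 64 * D\<^sup>2" using gw by linarith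
      then have "(real n / 4) * grid_statistic k a x \<le> (real n / 4) * (inner g w - 15 / 64 * D\<^sup>2)"
        by (intro mult_left_mono) auto
      with x show "x \<in> {x \<in> space C01. (- (real n / 4)) * inner (grid_step k a) w + real n * (15 / 256 * D\<^sup>2) \<le> (- (real n / 4)) * grid_statistic k a x}"
        by (simp add: g_def algebra_simps)
    qed
    then have "measure (white_noise_law N B n w) (space C01 - T)
        \<le> measure (white_noise_law N B n w) {x \<in> space C01. (- (real n / 4)) * inner (grid_step k a) w + real n * (15 / 256 * D\<^sup>2) \<le> (- (real n / 4)) * grid_statistic k a x}"
      by (intro finite_measure.finite_measure_mono prob_space.finite_measure prob_space_white_noise_law)
        (simp_all, measurable)
    also have "\<dots> \<le> exp ((- (real n / 4))\<^sup>2 * (norm (grid_step k a))\<^sup>2 / (2 * real n) - real n * (15 / 256 * D\<^sup>2))"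
      by (rule grid_statistic_tail[OF n k])
    also have "\<dots> \<le> exp (- (real n * D\<^sup>2 / 64))"
    proof -
      have "(- (real n / 4))\<^sup>2 * (norm g)\<^sup>2 / (2 * real n) = real n * (norm g)\<^sup>2 / 32"
        using n0 by (simp add: power2_eq_square field_simps)
      also have "\<dots> \<le> real n * (81 * D\<^sup>2 / 64) / 32"
        using gn n0 by (intro divide_right_mono mult_left_mono) auto
      finally show ?thesis
      using nD unfolding g_def exp_le_cancel_iff by linarith
    qed
    finally show ?thesis .
  qed
  from T 1 2 show ?thesis by blast
qed

end

section \<open>Posterior contraction\<close>

context brownian
begin

text \<open>The union of the tests against all centres at distance D >= 8 L \<epsilon> from
  \<open>w\<^sub>0\<close>. Then D^2/64 >= L^2 \<epsilon>^2 gives the rate, and D/8 >= 4 \<epsilon>,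
  by \<open>4 \<le> L\<close>, lets one test handle its whole covering ball. A signal further than
  (4 + 8 L) \<epsilon> away has such a centre. Only the first error pays for the number of
  centres.\<close>

lemma white_noise_test_covering:
  assumes n: "0 < n" and \<epsilon>: "0 < \<epsilon>" and L: "4 \<le> L"
    and T: "finite T" "X \<subseteq> (\<Union>t\<in>T. cball t (4 * \<epsilon>))"
  shows "\<exists>\<Phi>\<in>sets C01.
    measure (white_noise_law N B n w\<^sub>0) \<Phi> \<le> real (card T) * exp (- (L\<^sup>2 * (real n * \<epsilon>\<^sup>2))) \<and>
    (\<forall>w\<in>X. (4 + 8 * L) * \<epsilon> < norm (w - w\<^sub>0) \<longrightarrow>
      measure (white_noise_law N B n w) (space C01 - \<Phi>) \<le> exp (- (L\<^sup>2 * (real n * \<epsilon>\<^sup>2))))"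
proof -
  define T' where "T' = {t \<in> T. 8 * L * \<epsilon> \<le> norm (t - w\<^sub>0)}"
  let ?b = "exp (- (L\<^sup>2 * (real n * \<epsilon>\<^sup>2)))"
  have "\<forall>t\<in>T'. \<exists>S. S \<in> sets C01 \<and> measure (white_noise_law N B n w\<^sub>0) S \<le> ?b \<and>
      (\<forall>w. norm (w - t) \<le> 4 * \<epsilon> \<longrightarrow> measure (white_noise_law N B n w) (space C01 - S) \<le> ?b)"
  proof
    fix t assume "t \<in> T'"
    define D where "D = norm (t - w\<^sub>0)"
    have D: "8 * L * \<epsilon> \<le> D" using \<open>t \<in> T'\<close> by (simp add: T'_def D_def)
    have L\<epsilon>: "4 * \<epsilon> \<le> L * \<epsilon>" using L \<epsilon> by simp
    then have D0: "0 < D" and D8: "4 * \<epsilon> \<le> D / 8" using D \<epsilon> by linarith+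
    have "(L * \<epsilon>)\<^sup>2 \<le> (D / 8)\<^sup>2" using D L\<epsilon> \<epsilon> by (intro power_mono) auto
    then have "real n * (L\<^sup>2 * \<epsilon>\<^sup>2) \<le> real n * (D\<^sup>2 / 64)"
      by (intro mult_left_mono) (simp_all add: power_mult_distrib power_divide)
    then have le: "exp (- (real n * D\<^sup>2 / 64)) \<le> ?b" by (simp add: mult_ac)
    obtain S where S: "S \<in> sets C01" "measure (white_noise_law N B n w\<^sub>0) S \<le> exp (- (real n * D\<^sup>2 / 64))"
      "\<And>w. norm (w - t) \<le> D / 8 \<Longrightarrow> measure (white_noise_law N B n w) (space C01 - S) \<le> exp (- (real n * D\<^sup>2 / 64))"
      using white_noise_test[OF n D_def D0] by blast
    show "\<exists>S. S \<in> sets C01 \<and> measure (white_noise_law N B n w\<^sub>0) S \<le> ?b \<and>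
      (\<forall>w. norm (w - t) \<le> 4 * \<epsilon> \<longrightarrow> measure (white_noise_law N B n w) (space C01 - S) \<le> ?b)"
    proof (intro exI[of _ S] conjI allI impI S(1))
      show "measure (white_noise_law N B n w\<^sub>0) S \<le> ?b" using S(2) le by (rule order.trans)
      show "measure (white_noise_law N B n w) (space C01 - S) \<le> ?b" if "norm (w - t) \<le> 4 * \<epsilon>" for w
        using S(3)[OF order.trans[OF that D8]] le by (rule order.trans)
    qed
  qed
  then obtain S where S: "\<And>t. t \<in> T' \<Longrightarrow> S t \<in> sets C01"
    and S0: "\<And>t. t \<in> T' \<Longrightarrow> measure (white_noise_law N B n w\<^sub>0) (S t) \<le> ?b"
    and S1: "\<And>t w. t \<in> T' \<Longrightarrow> norm (w - t) \<le> 4 * \<epsilon> \<Longrightarrow> measure (white_noise_law N B n w) (space C01 - S t) \<le> ?b"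
    by metis
  have T': "finite T'" "card T' \<le> card T" using T(1) by (auto simp: T'_def intro: card_mono)
  define \<Phi> where "\<Phi> = (\<Union>t\<in>T'. S t)"
  have \<Phi>: "\<Phi> \<in> sets C01" unfolding \<Phi>_def using S T' by auto
  have "measure (white_noise_law N B n w\<^sub>0) \<Phi> \<le> (\<Sum>t\<in>T'. measure (white_noise_law N B n w\<^sub>0) (S t))"
    unfolding \<Phi>_def using S T' by (intro measure_UNION_le) auto
  also have "\<dots> \<le> real (card T') * ?b" using S0 by (intro sum_bounded_above) auto
  also have "\<dots> \<le> real (card T) * ?b" using T'(2) by (intro mult_right_mono) auto
  finally have 0: "measure (white_noise_law N B n w\<^sub>0) \<Phi> \<le> real (card T) * ?b" .
  have 1: "measure (white_noise_law N B n w) (space C01 - \<Phi>) \<le> ?b"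
    if w: "w \<in> X" "(4 + 8 * L) * \<epsilon> < norm (w - w\<^sub>0)" for w
  proof -
    obtain t where t: "t \<in> T" "norm (w - t) \<le> 4 * \<epsilon>"
      using w(1) T(2) by (auto simp: dist_norm norm_minus_commute)
    have "norm (w - w\<^sub>0) \<le> norm (w - t) + norm (t - w\<^sub>0)"
      using norm_triangle_ineq[of "w - t" "t - w\<^sub>0"] by simp
    then have "8 * L * \<epsilon> \<le> norm (t - w\<^sub>0)" using w(2) t(2) by (simp add: distrib_right)
    then have t': "t \<in> T'" using t(1) by (simp add: T'_def)
    have "measure (white_noise_law N B n w) (space C01 - \<Phi>) \<le> measure (white_noise_law N B n w) (space C01 - S t)"
      using t' S[OF t'] by (intro finite_measure.finite_measure_mono prob_space.finite_measure
          prob_space_white_noise_law) (auto simp: \<Phi>_def)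
    also have "\<dots> \<le> ?b" by (rule S1[OF t' t(2)])
    finally show ?thesis .
  qed
  from \<Phi> 0 1 show ?thesis by blast
qed

text \<open>The law \<open>P\<^sub>w\<^sub>0\<close> is compared with the marginal law \<open>\<integral> P\<^sub>w d\<mu>\<close>, under which the posterior mass
  of \<open>A\<close> integrates to the joint mass of \<open>A\<close>. The constants stay inside the integrals because
  measurability of \<open>w \<mapsto> P\<^sub>w E\<close> is not available.\<close>

lemma posterior_mass_bound:
  assumes n: "0 < n" and \<mu>: "prob_space \<mu>" "sets \<mu> = sets borel"
    and post: "is_posterior \<mu> C01 (white_noise_law N B n) \<kappa>"
    and A: "A \<in> sets borel" and X: "X \<in> sets borel" and E: "E \<in> sets C01"
    and \<delta>: "0 < \<delta>" "\<And>x. x \<in> E \<Longrightarrow> \<delta> < measure (\<kappa> x) A"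
    and b: "0 \<le> b" "\<And>w. w \<in> A \<inter> X \<Longrightarrow> measure (white_noise_law N B n w) E \<le> b"
    and r: "0 \<le> r"
  shows "\<delta> * ((measure (white_noise_law N B n w\<^sub>0) E)\<^sup>2 * exp (- (real n * r\<^sup>2))) * measure \<mu> (cball w\<^sub>0 r)
    \<le> measure \<mu> (- X) + b"
proof -
  interpret \<mu>: prob_space \<mu> by fact
  have sp: "space \<mu> = UNIV" using sets_eq_imp_space_eq[OF \<mu>(2)] by simp
  let ?P = "white_noise_law N B n"
  have finP: "emeasure (?P w) E = ennreal (measure (?P w) E)" for w
    by (intro finite_measure.emeasure_eq_measure prob_space.finite_measure prob_space_white_noise_law)
  \<comment> \<open>By the change of measure, \<open>c\<close> is at most \<delta> P_w(E) for every
    w in the ball, with a value independent of w.\<close>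
  define c where "c = \<delta> * ((measure (?P w\<^sub>0) E)\<^sup>2 * exp (- (real n * r\<^sup>2)))"
  have c: "0 \<le> c" using \<delta>(1) by (simp add: c_def)
  have ball: "cball w\<^sub>0 r \<in> sets \<mu>" using \<mu>(2) by simp
  have "ennreal c * emeasure \<mu> (cball w\<^sub>0 r) = (\<integral>\<^sup>+w. ennreal c * indicator (cball w\<^sub>0 r) w \<partial>\<mu>)"
    using ball by (simp add: nn_integral_cmult_indicator)
  also have "\<dots> \<le> (\<integral>\<^sup>+w. ennreal \<delta> * emeasure (?P w) E \<partial>\<mu>)"
  proof (rule nn_integral_mono)
    fix w
    show "ennreal c * indicator (cball w\<^sub>0 r) w \<le> ennreal \<delta> * emeasure (?P w) E"
    proof (cases "w \<in> cball w\<^sub>0 r")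
      case True
      then have "(norm (w\<^sub>0 - w))\<^sup>2 \<le> r\<^sup>2" by (intro power_mono) (auto simp: dist_norm)
      then have "(measure (?P w\<^sub>0) E)\<^sup>2 \<le> exp (real n * r\<^sup>2) * measure (?P w) E"
        by (intro order.trans[OF white_noise_change_of_measure[OF n E, of w\<^sub>0 w]] mult_right_mono)
          (auto intro: mult_left_mono)
      then have "(measure (?P w\<^sub>0) E)\<^sup>2 * exp (- (real n * r\<^sup>2)) \<le> measure (?P w) E"
        by (simp add: exp_minus field_simps)
      then have "c \<le> \<delta> * measure (?P w) E" unfolding c_def using \<delta>(1) by simp
      then show ?thesis using True \<delta>(1) by (simp add: finP ennreal_mult'[symmetric] ennreal_leI)
    qed simp
  qed
  also have "\<dots> \<le> (\<integral>\<^sup>+w. (\<integral>\<^sup>+x\<in>E. emeasure (\<kappa> x) A \<partial>?P w) \<partial>\<mu>)"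
  proof (rule nn_integral_mono)
    fix w
    have "ennreal \<delta> * emeasure (?P w) E = (\<integral>\<^sup>+x\<in>E. ennreal \<delta> \<partial>?P w)"
      using E by (simp add: nn_integral_cmult_indicator)
    also have "\<dots> \<le> (\<integral>\<^sup>+x\<in>E. emeasure (\<kappa> x) A \<partial>?P w)"
    proof (rule nn_integral_mono)
      fix x
      have "ennreal \<delta> \<le> emeasure (\<kappa> x) A" if "x \<in> E"
      proof -
        have "\<delta> < measure (\<kappa> x) A" by (rule \<delta>(2)[OF that])
        then have "ennreal \<delta> \<le> ennreal (measure (\<kappa> x) A)" by (intro ennreal_leI) simp
        also have "\<dots> \<le> emeasure (\<kappa> x) A" by (simp add: measure_def ennreal_enn2real_if)
        finally show ?thesis .
      qed
      then show "ennreal \<delta> * indicator E x \<le> emeasure (\<kappa> x) A * indicator E x"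
        by (simp add: indicator_def)
    qed
    finally show "ennreal \<delta> * emeasure (?P w) E \<le> (\<integral>\<^sup>+x\<in>E. emeasure (\<kappa> x) A \<partial>?P w)" .
  qed
  \<comment> \<open>The defining identity of the posterior, localised at \<open>E\<close>: the mass
    it assigns to \<open>A\<close> becomes the joint probability of \<open>A\<close> and
    \<open>E\<close>.\<close>
  also have "\<dots> = (\<integral>\<^sup>+w\<in>A. emeasure (?P w) E \<partial>\<mu>)"
    using post A E \<mu>(2) by (simp add: is_posterior_def)
  \<comment> \<open>Off the sieve P_w(E) is bounded by 1, on its intersection with \<open>A\<close>
    by \<open>b\<close>.\<close>
  also have "\<dots> \<le> (\<integral>\<^sup>+w. indicator (- X) w + ennreal b \<partial>\<mu>)"
  proof (rule nn_integral_mono)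
    fix w
    have "measure (?P w) E \<le> 1" by (intro prob_space.prob_le_1 prob_space_white_noise_law)
    then show "emeasure (?P w) E * indicator A w \<le> indicator (- X) w + ennreal b"
      using b by (auto simp: indicator_def finP ennreal_leI add_increasing2)
  qed
  also have "\<dots> = emeasure \<mu> (- X) + ennreal b"
    using X \<mu>(2) sp \<mu>.emeasure_space_1 by (subst nn_integral_add) (auto simp: borel_comp)
  finally have "ennreal (c * measure \<mu> (cball w\<^sub>0 r)) \<le> ennreal (measure \<mu> (- X) + b)"
    using b(1) c by (simp add: \<mu>.emeasure_eq_measure ennreal_mult)
  then show ?thesis using b(1) by (subst (asm) ennreal_le_iff) (auto simp: c_def)
qed

end

section \<open>Consequences of the entropy and concentration hypotheses\<close>

lemma covering_number_bound:
  assumes "ext_ln (ereal_of_enat (covering_number e A)) \<le> ereal r"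
  obtains T where "finite T" "A \<subseteq> (\<Union>t\<in>T. cball t e)" "real (card T) \<le> exp r"
proof -
  have "covering_number e A \<noteq> \<infinity>"
  proof
    assume "covering_number e A = \<infinity>"
    with assms show False by (simp add: ext_ln_def)
  qed
  then obtain m where m: "covering_number e A = enat m" by (cases "covering_number e A") auto
  \<comment> \<open>An infimum of natural numbers is attained; comparing it strictly with m + 1
    extracts a cover by at most m balls.\<close>
  then have "covering_number e A < enat (Suc m)" by simp
  then obtain T where T: "finite T" "A \<subseteq> (\<Union>t\<in>T. cball t e)" "card T < Suc m"
    unfolding covering_number_def INF_less_iff by auto
  \<comment> \<open>For \<open>m = 0\<close> the extended logarithm is minus infinity and says
    nothing about \<open>r\<close>, but 0 <= exp r holds anyway.\<close>
  have "real m \<le> exp r"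
  proof (cases "m = 0")
    case False
    then have "ln (real m) \<le> r" using assms by (simp add: m ext_ln_def)
    then have "exp (ln (real m)) \<le> exp r" by simp
    with False show ?thesis by simp
  qed simp
  then show thesis using T by (intro that[of T]) auto
qed

text \<open>Dropping the nonnegative infimum leaves the small ball bound. For the second claim
  attainment of the infimum is not presupposed: the additional \<open>r > 0\<close> in
  \<open>2 * r\<close> is the slack that produces an actual \<open>h\<close>.\<close>

lemma concentration_function_bound:
  assumes p: "0 < p" and r: "0 < r"
    and le: "concentration_function p \<gamma> \<psi> \<mu> w \<epsilon> \<le> ereal r"
  shows "exp (- r) \<le> measure \<mu> (cball 0 \<epsilon>)"
    and "\<exists>h\<in>Z_space p \<gamma> \<psi>. norm (h - w) \<le> \<epsilon> \<and>
      exp (- (2 * r)) \<le> exp (- (1 / p * Z_norm_pow p \<gamma> \<psi> h)) * measure \<mu> (cball 0 \<epsilon>)"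
proof -
  define m where "m = measure \<mu> (cball 0 \<epsilon>)"
  define I where "I = (INF h\<in>{h \<in> Z_space p \<gamma> \<psi>. norm (h - w) \<le> \<epsilon>}. ereal (1 / p * Z_norm_pow p \<gamma> \<psi> h))"
  have le': "I - ext_ln (ereal m) \<le> ereal r"
    using le by (simp add: concentration_function_def I_def m_def)
  have "0 \<le> I"
    unfolding I_def using p
    by (intro INF_greatest) (auto simp: Z_norm_pow_def Z_space_def intro!: divide_nonneg_pos suminf_nonneg)
  \<comment> \<open>A ball of measure zero has logarithm minus infinity and would make the
    concentration function infinite.\<close>
  have m0: "0 < m"
  proof (rule ccontr)
    assume "\<not> 0 < m"
    then have "m = 0" using measure_nonneg[of \<mu> "cball 0 \<epsilon>"] by (simp add: m_def)
    with le' \<open>0 \<le> I\<close> show False by (cases I) (auto simp: ext_ln_def)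
  qed
  then have I: "I \<le> ereal (r + ln m)"
    using le' \<open>0 \<le> I\<close> by (cases I) (auto simp: ext_ln_def)
  with \<open>0 \<le> I\<close> have "0 \<le> r + ln m" by (metis ereal_less_eq(3) order.trans zero_ereal_def)
  then have "exp (- r) \<le> exp (ln m)" by (subst exp_le_cancel_iff) linarith
  also have "\<dots> = m" using m0 by (rule exp_ln)
  finally show "exp (- r) \<le> measure \<mu> (cball 0 \<epsilon>)" by (simp add: m_def)
  have "I < ereal (2 * r + ln m)" using I r by (auto intro: order.strict_trans1)
  then obtain h where h: "h \<in> Z_space p \<gamma> \<psi>" "norm (h - w) \<le> \<epsilon>"
    and hr: "1 / p * Z_norm_pow p \<gamma> \<psi> h < 2 * r + ln m"
    unfolding I_def INF_less_iff by auto
  have "exp (- (2 * r)) \<le> exp (- (1 / p * Z_norm_pow p \<gamma> \<psi> h) + ln m)" using hr by simp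
  also have "\<dots> = exp (- (1 / p * Z_norm_pow p \<gamma> \<psi> h)) * m" unfolding exp_add using m0 by simp
  finally show "\<exists>h\<in>Z_space p \<gamma> \<psi>. norm (h - w) \<le> \<epsilon> \<and>
      exp (- (2 * r)) \<le> exp (- (1 / p * Z_norm_pow p \<gamma> \<psi> h)) * measure \<mu> (cball 0 \<epsilon>)"
    using h by (auto simp: m_def)
qed

text \<open>The radius 3\<epsilon> consists of 2\<epsilon> from
  \<open>p_exponential_shifted_ball\<close> around \<open>h\<close> and \<epsilon> for the distance
  of \<open>h\<close> from \<open>w\<close>.\<close>

lemma p_exponential_ball_lower_bound:
  fixes W :: "'a \<Rightarrow> 'x::real_inner"
  assumes p: "0 < p" "p \<le> 2" and W: "p_exponential_element p \<gamma> \<psi> \<Omega> W"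
    and r: "0 < r" and \<epsilon>: "0 < \<epsilon>"
    and le: "concentration_function p \<gamma> \<psi> (distr \<Omega> borel W) w \<epsilon> \<le> ereal r"
  shows "exp (- (2 * r)) \<le> measure (distr \<Omega> borel W) (cball w (3 * \<epsilon>))"
proof -
  interpret prob_space \<Omega> using W by (simp add: p_exponential_element_def)
  have Wm: "W \<in> borel_measurable \<Omega>" using W by (simp add: p_exponential_element_def)
  obtain h where h: "h \<in> Z_space p \<gamma> \<psi>" "norm (h - w) \<le> \<epsilon>"
    and hr: "exp (- (2 * r)) \<le> exp (- (1 / p * Z_norm_pow p \<gamma> \<psi> h)) * measure (distr \<Omega> borel W) (cball 0 \<epsilon>)"
    using concentration_function_bound(2)[OF p(1) r le] by blast
  have ball: "measure (distr \<Omega> borel W) (cball x s) = prob {\<omega> \<in> space \<Omega>. norm (W \<omega> - x) \<le> s}" for x s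
    using Wm by (subst measure_distr) (auto simp: dist_norm norm_minus_commute intro!: arg_cong[where f=prob])
  note hr
  also have "exp (- (1 / p * Z_norm_pow p \<gamma> \<psi> h)) * measure (distr \<Omega> borel W) (cball 0 \<epsilon>)
      \<le> measure (distr \<Omega> borel W) (cball h (2 * \<epsilon>))"
    using p_exponential_shifted_ball[OF p W h(1) \<epsilon>] by (simp add: ball)
  also have "\<dots> \<le> measure (distr \<Omega> borel W) (cball w (3 * \<epsilon>))"
  proof (rule finite_measure.finite_measure_mono)
    show "finite_measure (distr \<Omega> borel W)"
      by (rule prob_space.finite_measure[OF prob_space_distr[OF Wm]])
    show "cball h (2 * \<epsilon>) \<subseteq> cball w (3 * \<epsilon>)"
    proof
      fix x assume "x \<in> cball h (2 * \<epsilon>)"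
      then show "x \<in> cball w (3 * \<epsilon>)"
        using dist_triangle[of w x h] h(2) by (simp add: dist_norm norm_minus_commute)
    qed
  qed simp
  finally show ?thesis .
qed

text \<open>The centred small ball probabilities vanish in the limit because \<open>W\<close> has no atom at \<open>0\<close>.\<close>

lemma contraction_exponent_at_top:
  fixes W :: "'a \<Rightarrow> 'x::real_normed_vector"
  assumes p: "0 < p" and W: "p_exponential_element p \<gamma> \<psi> \<Omega> W"
    and \<epsilon>: "\<forall>n\<ge>1. 0 < \<epsilon> n"
    and le: "\<forall>n\<ge>1. concentration_function p \<gamma> \<psi> (distr \<Omega> borel W) w (\<epsilon> n) \<le> ereal (real n * (\<epsilon> n)\<^sup>2)"
  shows "filterlim (\<lambda>n. real n * (\<epsilon> n)\<^sup>2) at_top sequentially"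
  unfolding filterlim_at_top
proof
  fix K :: real
  let ?\<mu> = "distr \<Omega> borel W"
  interpret prob_space \<Omega> using W by (simp add: p_exponential_element_def)
  have Wm: "W \<in> borel_measurable \<Omega>" using W by (simp add: p_exponential_element_def)
  interpret \<mu>: prob_space ?\<mu> by (rule prob_space_distr[OF Wm])
  have "(\<lambda>j. measure ?\<mu> (cball 0 (1 / real (Suc j)))) \<longlonglongrightarrow> measure ?\<mu> (\<Inter>j. cball 0 (1 / real (Suc j)))"
    by (intro \<mu>.finite_Lim_measure_decseq)
      (auto simp: decseq_def frac_le intro!: subset_cball simp del: of_nat_Suc)
  moreover have "(\<Inter>j. cball 0 (1 / real (Suc j))) = {0::'x}"
  proof (intro equalityI subsetI)
    fix x :: 'x assume x: "x \<in> (\<Inter>j. cball 0 (1 / real (Suc j)))"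
    show "x \<in> {0}"
    proof (rule ccontr)
      assume "x \<notin> {0}"
      then obtain j where "inverse (real (Suc j)) < norm x" using reals_Archimedean[of "norm x"] by auto
      moreover have "norm x \<le> 1 / real (Suc j)" using x by (simp del: of_nat_Suc)
      ultimately show False by (simp add: inverse_eq_divide del: of_nat_Suc)
    qed
  qed auto
  moreover have "measure ?\<mu> {0} = 0"
    using p_exponential_nonatomic_zero[OF W] Wm
    by (subst measure_distr) (auto simp: vimage_def Int_def conj_commute)
  ultimately have "(\<lambda>j. measure ?\<mu> (cball 0 (1 / real (Suc j)))) \<longlonglongrightarrow> 0" by simp
  then have "eventually (\<lambda>j. measure ?\<mu> (cball 0 (1 / real (Suc j))) < exp (- K)) sequentially"
    by (rule order_tendstoD) simp
  then obtain j where j: "measure ?\<mu> (cball 0 (1 / real (Suc j))) < exp (- K)"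
    by (auto simp: eventually_sequentially)
  define s where "s = 1 / real (Suc j)"
  have s: "0 < s" by (simp add: s_def)
  \<comment> \<open>If n \<epsilon>_n^2 stayed below K, the ball of radius \<epsilon>_n would have
    mass at least exp(-K), which forces \<epsilon>_n > s and hence n s^2 < K. This fails once n >=
    K/s^2.\<close>
  obtain m :: nat where m: "K / s\<^sup>2 \<le> real m" using real_arch_simple by blast
  show "eventually (\<lambda>n. K \<le> real n * (\<epsilon> n)\<^sup>2) sequentially"
  proof (rule eventually_sequentiallyI[of "max 1 m"])
    fix n assume "max 1 m \<le> n"
    then have n: "1 \<le> n" "m \<le> n" by auto
    show "K \<le> real n * (\<epsilon> n)\<^sup>2"
    proof (rule ccontr)
      assume "\<not> K \<le> real n * (\<epsilon> n)\<^sup>2"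
      then have lt: "real n * (\<epsilon> n)\<^sup>2 < K" by simp
      have \<epsilon>n: "0 < \<epsilon> n" using \<epsilon> n(1) by simp
      then have "0 < real n * (\<epsilon> n)\<^sup>2" using n(1) by simp
      then have "exp (- (real n * (\<epsilon> n)\<^sup>2)) \<le> measure ?\<mu> (cball 0 (\<epsilon> n))"
        using concentration_function_bound(1)[OF p] le n(1) by blast
      with j lt have "measure ?\<mu> (cball 0 s) < measure ?\<mu> (cball 0 (\<epsilon> n))"
        unfolding s_def by (smt (verit) exp_le_cancel_iff)
      then have "\<not> cball (0::'x) (\<epsilon> n) \<subseteq> cball 0 s"
        using \<mu>.finite_measure_mono[of "cball 0 (\<epsilon> n)" "cball 0 s"] by force
      then have "s < \<epsilon> n" using subset_cball[of "\<epsilon> n" s] by force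
      then have "s\<^sup>2 \<le> (\<epsilon> n)\<^sup>2" using s by (intro power_mono) auto
      then have "real n * s\<^sup>2 < K" using lt mult_left_mono[of "s\<^sup>2" "(\<epsilon> n)\<^sup>2" "real n"] by linarith
      then have "real n < K / s\<^sup>2" using s by (simp add: pos_less_divide_eq)
      with m n(2) show False by linarith
    qed
  qed
qed

theorem theorem4p2:
  fixes p :: real
    and \<gamma> :: "nat \<Rightarrow> real"
    and \<psi> :: "nat \<Rightarrow> L2"
    and \<Omega> :: "'a measure"
    and W :: "'a \<Rightarrow> L2"
    and N :: "'b measure"
    and B :: "real \<Rightarrow> 'b \<Rightarrow> real"
    and \<mu> :: "L2 measure"
    and post :: "nat \<Rightarrow> (real \<Rightarrow> real) \<Rightarrow> L2 measure"
    and w\<^sub>0 :: L2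
    and \<epsilon> :: "nat \<Rightarrow> real"
  assumes "1 \<le> p" and "p \<le> 2"
    and "p_exponential_element p \<gamma> \<psi> \<Omega> W"
    and "\<mu> = distr \<Omega> borel W"
    and "brownian_motion01 N B"
    and "\<forall>n\<ge>1. is_posterior \<mu> C01 (white_noise_law N B n) (post n)"
    and "w\<^sub>0 \<in> measure_support \<mu>"
    and "\<forall>n\<ge>1. 0 < \<epsilon> n"
    and "\<forall>n\<ge>1. concentration_function p \<gamma> \<psi> \<mu> w\<^sub>0 (\<epsilon> n) \<le> ereal (real n * (\<epsilon> n)\<^sup>2)"
    and "\<forall>C>1. \<exists>R>0. \<exists>X :: nat \<Rightarrow> L2 set. \<forall>n\<ge>1.
           X n \<in> sets borel \<and>
           ext_ln (ereal_of_enat (covering_number (4 * \<epsilon> n) (X n))) \<le> ereal (R * real n * (\<epsilon> n)\<^sup>2) \<and>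
           measure \<Omega> {\<omega> \<in> space \<Omega>. W \<omega> \<notin> X n} \<le> exp (- (C * real n * (\<epsilon> n)\<^sup>2))"
  shows "\<exists>M>0. \<forall>\<delta>>0.
           (\<lambda>n. measure (white_noise_law N B n w\<^sub>0)
                  {x \<in> space C01. \<delta> < measure (post n x) {w. M * \<epsilon> n < norm (w - w\<^sub>0)}})
             \<longlonglongrightarrow> 0"
proof -
  have p: "0 < p" "p \<le> 2" using assms(1,2) by auto
  note W = assms(3) and \<mu>_def = assms(4) and \<epsilon> = assms(8)
  interpret brownian N B by unfold_locales (rule assms(5))
  interpret \<Omega>: prob_space \<Omega> using W by (simp add: p_exponential_element_def)
  have Wm: "W \<in> borel_measurable \<Omega>" using W by (simp add: p_exponential_element_def)
  have \<mu>: "prob_space \<mu>" "sets \<mu> = sets borel"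
    unfolding \<mu>_def by (auto intro: \<Omega>.prob_space_distr Wm)
  \<comment> \<open>C = 12 exceeds 9 + 2, the exponents lost to the change of measure over radius
    3\<epsilon> and to the prior mass of that ball; the surplus 1 is the final rate.\<close>
  obtain R X where R: "0 < R" and X: "\<And>n. 1 \<le> n \<Longrightarrow> X n \<in> sets borel"
    and cov: "\<And>n. 1 \<le> n \<Longrightarrow>
      ext_ln (ereal_of_enat (covering_number (4 * \<epsilon> n) (X n))) \<le> ereal (R * real n * (\<epsilon> n)\<^sup>2)"
    and out: "\<And>n. 1 \<le> n \<Longrightarrow>
      measure \<Omega> {\<omega> \<in> space \<Omega>. W \<omega> \<notin> X n} \<le> exp (- (12 * real n * (\<epsilon> n)\<^sup>2))"
    using assms(10)[rule_format, of 12] by auto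
  \<comment> \<open>L^2 >= R + 12 pays for the exp(R y) covering balls in the first error of the
    test and matches the sieve exponent 12 in the second; L >= 4 is required by the covering
    argument.\<close>
  define L where "L = R + 12"
  have L: "4 \<le> L" "R + 12 \<le> L\<^sup>2"
    using R by (auto simp: L_def power2_eq_square algebra_simps)
  define M where "M = 4 + 8 * L"
  define y where "y n = real n * (\<epsilon> n)\<^sup>2" for n
  have y_top: "filterlim y at_top sequentially"
    unfolding y_def[abs_def]
    using contraction_exponent_at_top[OF p(1) W \<epsilon>] assms(9) by (simp add: \<mu>_def)
  have bound: "measure (white_noise_law N B n w\<^sub>0)
      {x \<in> space C01. \<delta> < measure (post n x) {w. M * \<epsilon> n < norm (w - w\<^sub>0)}}
      \<le> exp (- y n) + sqrt (2 / \<delta> * exp (- y n))" if \<delta>: "0 < \<delta>" and n: "1 \<le> n" for \<delta> n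
  proof -
    let ?P = "white_noise_law N B n"
    let ?A = "{w. M * \<epsilon> n < norm (w - w\<^sub>0)}"
    have n0: "0 < n" and \<epsilon>n: "0 < \<epsilon> n" using n \<epsilon> by auto
    have y: "0 < y n" using n0 \<epsilon>n by (simp add: y_def)
    have A: "?A \<in> sets borel" by (intro borel_open open_Collect_less continuous_intros)
    have L2: "(R + 12) * y n \<le> L\<^sup>2 * y n" using L y by (intro mult_right_mono) auto
    obtain T where T: "finite T" "X n \<subseteq> (\<Union>t\<in>T. cball t (4 * \<epsilon> n))" "real (card T) \<le> exp (R * y n)"
      using covering_number_bound[OF cov[OF n]] by (auto simp: y_def mult.assoc)
    obtain \<Phi> where \<Phi>: "\<Phi> \<in> sets C01" and \<Phi>0: "measure (?P w\<^sub>0) \<Phi> \<le> real (card T) * exp (- (L\<^sup>2 * y n))"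
      and \<Phi>1: "\<And>w. w \<in> X n \<Longrightarrow> w \<in> ?A \<Longrightarrow> measure (?P w) (space C01 - \<Phi>) \<le> exp (- (L\<^sup>2 * y n))"
      using white_noise_test_covering[OF n0 \<epsilon>n L(1) T(1,2), of w\<^sub>0] by (auto simp: M_def y_def)
    have "post n \<in> measurable C01 (subprob_algebra \<mu>)"
      using assms(6) n by (auto simp: is_posterior_def intro: measurable_prob_algebraD)
    then have post_m: "(\<lambda>x. measure (post n x) ?A) \<in> borel_measurable C01"
      by (rule measurable_compose[OF _ measurable_measure_subprob_algebra]) (use A \<mu>(2) in simp)
    define G where "G = {x \<in> space C01. \<delta> < measure (post n x) ?A}"
    have G: "G \<in> sets C01" unfolding G_def using post_m by measurable
    \<comment> \<open>The paths on which the test accepts although the posterior misplaces more than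
      \<delta>. On \<open>\<Phi>\<close> the first error of the test suffices.\<close>
    define E where "E = G - \<Phi>"
    have E: "E \<in> sets C01" unfolding E_def using G \<Phi> by auto
    have "\<delta> * ((measure (?P w\<^sub>0) E)\<^sup>2 * exp (- (real n * (3 * \<epsilon> n)\<^sup>2))) * measure \<mu> (cball w\<^sub>0 (3 * \<epsilon> n))
        \<le> measure \<mu> (- X n) + exp (- (L\<^sup>2 * y n))"
    proof (rule posterior_mass_bound[OF n0 \<mu> _ A X[OF n] E \<delta>])
      show "is_posterior \<mu> C01 (white_noise_law N B n) (post n)" using assms(6) n by auto
      show "measure (?P w) E \<le> exp (- (L\<^sup>2 * y n))" if "w \<in> ?A \<inter> X n" for w
      proof -
        have "measure (?P w) E \<le> measure (?P w) (space C01 - \<Phi>)"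
          using \<Phi> by (intro finite_measure.finite_measure_mono prob_space.finite_measure
              prob_space_white_noise_law) (auto simp: E_def G_def)
        also have "\<dots> \<le> exp (- (L\<^sup>2 * y n))" using that by (intro \<Phi>1) auto
        finally show ?thesis .
      qed
    qed (use \<epsilon>n in \<open>auto simp: E_def G_def\<close>)
    also have "measure \<mu> (- X n) \<le> exp (- (12 * y n))"
    proof -
      have "measure \<mu> (- X n) = measure \<Omega> {\<omega> \<in> space \<Omega>. W \<omega> \<notin> X n}"
        unfolding \<mu>_def using Wm X[OF n]
        by (subst measure_distr) (auto simp: borel_comp intro!: arg_cong[where f="measure \<Omega>"])
      then show ?thesis using out[OF n] by (simp add: y_def mult.assoc)
    qed
    also have "exp (- (L\<^sup>2 * y n)) \<le> exp (- (12 * y n))"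
      using L2 mult_pos_pos[OF R y] by (simp add: distrib_right)
    also have "exp (- (real n * (3 * \<epsilon> n)\<^sup>2)) = exp (- (9 * y n))"
      by (simp add: y_def power_mult_distrib)
    finally have *: "\<delta> * ((measure (?P w\<^sub>0) E)\<^sup>2 * exp (- (9 * y n))) * measure \<mu> (cball w\<^sub>0 (3 * \<epsilon> n)) \<le> 2 * exp (- (12 * y n))"
      by simp
    have ball: "exp (- (2 * y n)) \<le> measure \<mu> (cball w\<^sub>0 (3 * \<epsilon> n))"
      unfolding \<mu>_def using assms(9) n y
      by (intro p_exponential_ball_lower_bound[OF p W y \<epsilon>n]) (auto simp: \<mu>_def y_def)
    have "\<delta> * (measure (?P w\<^sub>0) E)\<^sup>2 * exp (- (11 * y n))
        = \<delta> * ((measure (?P w\<^sub>0) E)\<^sup>2 * exp (- (9 * y n))) * exp (- (2 * y n))"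
      by (simp add: mult_exp_exp)
    also have "\<dots> \<le> \<delta> * ((measure (?P w\<^sub>0) E)\<^sup>2 * exp (- (9 * y n))) * measure \<mu> (cball w\<^sub>0 (3 * \<epsilon> n))"
      using ball \<delta> by (intro mult_left_mono) auto
    also note *
    \<comment> \<open>Cancelling the loss exp(-11 y) leaves exp(-y) as a bound for the square of the
      probability, whence the square root in the final estimate.\<close>
    also have "2 * exp (- (12 * y n)) = 2 * exp (- y n) * exp (- (11 * y n))"
      by (simp add: mult_exp_exp)
    finally have "\<delta> * (measure (?P w\<^sub>0) E)\<^sup>2 \<le> 2 * exp (- y n)" by simp
    then have "(measure (?P w\<^sub>0) E)\<^sup>2 \<le> 2 / \<delta> * exp (- y n)" using \<delta> by (simp add: field_simps)
    then have E_le: "measure (?P w\<^sub>0) E \<le> sqrt (2 / \<delta> * exp (- y n))" by (rule real_le_rsqrt)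
    have "measure (?P w\<^sub>0) \<Phi> \<le> exp (R * y n) * exp (- (L\<^sup>2 * y n))"
      using \<Phi>0 mult_right_mono[OF T(3) exp_ge_zero] by (rule order.trans)
    also have "\<dots> \<le> exp (- y n)"
      using L2 y by (simp add: mult_exp_exp distrib_right)
    finally have \<Phi>_le: "measure (?P w\<^sub>0) \<Phi> \<le> exp (- y n)" .
    have "measure (?P w\<^sub>0) G \<le> measure (?P w\<^sub>0) (\<Phi> \<union> E)"
      using G sets.Un[OF \<Phi> E] by (intro finite_measure.finite_measure_mono prob_space.finite_measure
          prob_space_white_noise_law) (auto simp: E_def)
    also have "\<dots> \<le> measure (?P w\<^sub>0) \<Phi> + measure (?P w\<^sub>0) E"
      using \<Phi> E by (intro measure_Un_le) auto
    finally show ?thesis using \<Phi>_le E_le by (simp add: G_def)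
  qed
  have "(\<lambda>n. measure (white_noise_law N B n w\<^sub>0)
      {x \<in> space C01. \<delta> < measure (post n x) {w. M * \<epsilon> n < norm (w - w\<^sub>0)}}) \<longlonglongrightarrow> 0"
    if \<delta>: "0 < \<delta>" for \<delta>
  proof (rule tendsto_sandwich[of "\<lambda>_. 0"])
    have e: "(\<lambda>n. exp (- y n)) \<longlonglongrightarrow> 0"
      by (intro filterlim_compose[OF exp_at_bot] filterlim_compose[OF filterlim_uminus_at_bot_at_top] y_top)
    have "(\<lambda>n. exp (- y n) + sqrt (2 / \<delta> * exp (- y n))) \<longlonglongrightarrow> 0 + sqrt (2 / \<delta> * 0)"
      by (intro tendsto_intros e)
    then show "(\<lambda>n. exp (- y n) + sqrt (2 / \<delta> * exp (- y n))) \<longlonglongrightarrow> 0" by simp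
    show "eventually (\<lambda>n. measure (white_noise_law N B n w\<^sub>0)
        {x \<in> space C01. \<delta> < measure (post n x) {w. M * \<epsilon> n < norm (w - w\<^sub>0)}}
        \<le> exp (- y n) + sqrt (2 / \<delta> * exp (- y n))) sequentially"
      using bound[OF \<delta>] by (intro eventually_sequentiallyI[of 1]) auto
  qed auto
  moreover have "0 < M" using L(1) by (simp add: M_def)
  ultimately show ?thesis by blast
qed

end
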